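(* Let $R=R_1\times R_2\times\cdots\times R_n$ be a direct product of commutative rings $R_1,\dots,R_n$, and let $S=S_1\times S_2\times\cdots\times S_n$ be a Cartesian product of multiplicative subsets $S_i$ of $R_i$ ($i=1,\dots,n$). An $R$-module $M=M_1\times M_2\times\cdots\times M_n$ is $S$-projective (resp., $S$-flat) if and only if the induced $R_i$-module $M_i$ is $S_i$-projective (resp., $S_i$-flat) for each $i=1,\dots,n$.
   Context: A multiplicative subset $T$ of a commutative ring $A$ satisfies $1\in T$, is closed under multiplication, and $0\notin T$. $N_T\cong N\otimes_A A_T$ denotes localization at $T$. An $A$-module $N$ is $T$-flat if $N_T$ is a flat $A_T$-module, and $T$-projective if $N_T$ is projective as an $A$-module. Every $R$-module decomposes as $M=M_1\times\cdots\times M_n$ with $M_i=e_iM$ an $R_i$-module, where $e_i\in R$ has $i$-th component $1$ and other components $0$. *)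

theory Defs
  imports "HOL-Algebra.Module" "HOL-Algebra.Chinese_Remainder" "HOL-Algebra.Free_Abelian_Groups"
begin

definition multiplicative_subset :: "('a, 'm) ring_scheme \<Rightarrow> 'a set \<Rightarrow> bool" where
  "multiplicative_subset A T \<longleftrightarrow> submonoid T A \<and> \<zero>\<^bsub>A\<^esub> \<notin> T"


subsection \<open>Localization\<close>

text \<open>
  Modules are records extending rings, so every module carries fields \<open>mult\<close> and \<open>one\<close>.
  They have no meaning for a module and are left \<open>undefined\<close> below.
\<close>

definition ring_as_module :: "('a, 'm) ring_scheme \<Rightarrow> ('a, 'a) module" where
  "ring_as_module A =
     \<lparr>carrier = carrier A, monoid.mult = undefined, monoid.one = undefined,
      ring.zero = \<zero>\<^bsub>A\<^esub>, add = add A, smult = monoid.mult A\<rparr>"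

text \<open>
  A pair \<open>(m, s)\<close> stands for the fraction \<open>m / s\<close>. The factor \<open>u\<close> is needed because
  elements of \<open>T\<close> may be zero divisors.
\<close>

definition fraction_rel ::
    "'a set \<Rightarrow> ('a, 'b, 'k) module_scheme \<Rightarrow> (('b \<times> 'a) \<times> ('b \<times> 'a)) set" where
  "fraction_rel T N =
     {((m, s), (n, t)) | m s n t.
        m \<in> carrier N \<and> s \<in> T \<and> n \<in> carrier N \<and> t \<in> T \<and>
        (\<exists>u\<in>T. u \<odot>\<^bsub>N\<^esub> (t \<odot>\<^bsub>N\<^esub> m) = u \<odot>\<^bsub>N\<^esub> (s \<odot>\<^bsub>N\<^esub> n))}"

definition fraction ::
    "'a set \<Rightarrow> ('a, 'b, 'k) module_scheme \<Rightarrow> 'b \<Rightarrow> 'a \<Rightarrow> ('b \<times> 'a) set" where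
  "fraction T N m s = fraction_rel T N `` {(m, s)}"

text \<open>
  Operations on fractions are given on representatives; the unions range over equal sets, since
  the values do not depend on the representatives.
\<close>

definition fraction_add ::
    "('a, 'm) ring_scheme \<Rightarrow> 'a set \<Rightarrow> ('a, 'b, 'k) module_scheme \<Rightarrow>
       ('b \<times> 'a) set \<Rightarrow> ('b \<times> 'a) set \<Rightarrow> ('b \<times> 'a) set" where
  "fraction_add A T N X Y =
     (\<Union>(m, s)\<in>X. \<Union>(n, t)\<in>Y.
        fraction T N (t \<odot>\<^bsub>N\<^esub> m \<oplus>\<^bsub>N\<^esub> s \<odot>\<^bsub>N\<^esub> n) (s \<otimes>\<^bsub>A\<^esub> t))"

definition fraction_smult ::
    "('a, 'm) ring_scheme \<Rightarrow> 'a set \<Rightarrow> ('a, 'b, 'k) module_scheme \<Rightarrow>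
       ('a \<times> 'a) set \<Rightarrow> ('b \<times> 'a) set \<Rightarrow> ('b \<times> 'a) set" where
  "fraction_smult A T N X Y =
     (\<Union>(a, s)\<in>X. \<Union>(n, t)\<in>Y. fraction T N (a \<odot>\<^bsub>N\<^esub> n) (s \<otimes>\<^bsub>A\<^esub> t))"

definition localized_ring :: "('a, 'm) ring_scheme \<Rightarrow> 'a set \<Rightarrow> ('a \<times> 'a) set ring" where
  "localized_ring A T =
     \<lparr>carrier = (carrier A \<times> T) // fraction_rel T (ring_as_module A),
      monoid.mult = fraction_smult A T (ring_as_module A),
      monoid.one = fraction T (ring_as_module A) \<one>\<^bsub>A\<^esub> \<one>\<^bsub>A\<^esub>,
      ring.zero = fraction T (ring_as_module A) \<zero>\<^bsub>A\<^esub> \<one>\<^bsub>A\<^esub>,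
      add = fraction_add A T (ring_as_module A)\<rparr>"

definition localized_module ::
    "('a, 'm) ring_scheme \<Rightarrow> 'a set \<Rightarrow> ('a, 'b, 'k) module_scheme \<Rightarrow>
       (('a \<times> 'a) set, ('b \<times> 'a) set) module" where
  "localized_module A T N =
     \<lparr>carrier = (carrier N \<times> T) // fraction_rel T N,
      monoid.mult = undefined, monoid.one = undefined,
      ring.zero = fraction T N \<zero>\<^bsub>N\<^esub> \<one>\<^bsub>A\<^esub>,
      add = fraction_add A T N,
      smult = fraction_smult A T N\<rparr>"

definition restrict_scalars ::
    "('a \<Rightarrow> 'r) \<Rightarrow> ('r, 'b, 'k) module_scheme \<Rightarrow> ('a, 'b) module" where
  "restrict_scalars \<phi> N =
     \<lparr>carrier = carrier N, monoid.mult = undefined, monoid.one = undefined,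
      ring.zero = \<zero>\<^bsub>N\<^esub>, add = add N, smult = (\<lambda>a x. \<phi> a \<odot>\<^bsub>N\<^esub> x)\<rparr>"

definition localization_map :: "('a, 'm) ring_scheme \<Rightarrow> 'a set \<Rightarrow> 'a \<Rightarrow> ('a \<times> 'a) set" where
  "localization_map A T a = fraction T (ring_as_module A) a \<one>\<^bsub>A\<^esub>"


subsection \<open>Projective and flat modules\<close>

definition linear_maps ::
    "('a, 'm) ring_scheme \<Rightarrow> ('a, 'b, 'k) module_scheme \<Rightarrow> ('a, 'c, 'l) module_scheme \<Rightarrow>
       ('b \<Rightarrow> 'c) set" where
  "linear_maps A M N =
     {f \<in> carrier M \<rightarrow> carrier N.
        (\<forall>x\<in>carrier M. \<forall>y\<in>carrier M. f (x \<oplus>\<^bsub>M\<^esub> y) = f x \<oplus>\<^bsub>N\<^esub> f y) \<and>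
        (\<forall>a\<in>carrier A. \<forall>x\<in>carrier M. f (a \<odot>\<^bsub>M\<^esub> x) = a \<odot>\<^bsub>N\<^esub> f x)}"

text \<open>
  Projectivity (lifting along surjections) and flatness (tensoring preserves injectivity) quantify
  over all modules. HOL cannot quantify over types inside a formula, so the type \<open>'c\<close> of
  the test modules is an explicit parameter; it plays the role of a universe. A module is projective
  (flat) in the ordinary sense iff it is so for every \<open>'c\<close>. For small \<open>'c\<close> the
  condition is weaker, so statements should leave \<open>'c\<close> arbitrary.
\<close>

definition projective_module ::
    "'c itself \<Rightarrow> ('a, 'm) ring_scheme \<Rightarrow> ('a, 'b, 'k) module_scheme \<Rightarrow> bool" where
  "projective_module U A N \<longleftrightarrow>
     module A N \<and>
     (\<forall>(P :: ('a, 'c) module) (Q :: ('a, 'c) module) g f.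
        module A P \<and> module A Q \<and>
        g \<in> linear_maps A P Q \<and> g ` carrier P = carrier Q \<and> f \<in> linear_maps A N Q \<longrightarrow>
        (\<exists>h\<in>linear_maps A N P. \<forall>x\<in>carrier N. g (h x) = f x))"

text \<open>
  The tensor product is only needed as an abelian group: the free abelian group on pairs modulo the
  relations of additivity in each argument and \<open>(a x) \<otimes> y = x \<otimes> (a y)\<close>.
\<close>

definition tensor_relations ::
    "('a, 'm) ring_scheme \<Rightarrow> ('a, 'b, 'k) module_scheme \<Rightarrow> ('a, 'c, 'l) module_scheme \<Rightarrow>
       (('b \<times> 'c) \<Rightarrow>\<^sub>0 int) set" where
  "tensor_relations A P N =
     {frag_of (x \<oplus>\<^bsub>P\<^esub> x', y) - frag_of (x, y) - frag_of (x', y) | x x' y.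
        x \<in> carrier P \<and> x' \<in> carrier P \<and> y \<in> carrier N} \<union>
     {frag_of (x, y \<oplus>\<^bsub>N\<^esub> y') - frag_of (x, y) - frag_of (x, y') | x y y'.
        x \<in> carrier P \<and> y \<in> carrier N \<and> y' \<in> carrier N} \<union>
     {frag_of (a \<odot>\<^bsub>P\<^esub> x, y) - frag_of (x, a \<odot>\<^bsub>N\<^esub> y) | a x y.
        a \<in> carrier A \<and> x \<in> carrier P \<and> y \<in> carrier N}"

definition tensor_kernel ::
    "('a, 'm) ring_scheme \<Rightarrow> ('a, 'b, 'k) module_scheme \<Rightarrow> ('a, 'c, 'l) module_scheme \<Rightarrow>
       (('b \<times> 'c) \<Rightarrow>\<^sub>0 int) set" where
  "tensor_kernel A P N =
     generate (free_Abelian_group (carrier P \<times> carrier N)) (tensor_relations A P N)"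

definition tensor_product ::
    "('a, 'm) ring_scheme \<Rightarrow> ('a, 'b, 'k) module_scheme \<Rightarrow> ('a, 'c, 'l) module_scheme \<Rightarrow>
       (('b \<times> 'c) \<Rightarrow>\<^sub>0 int) set monoid" where
  "tensor_product A P N =
     free_Abelian_group (carrier P \<times> carrier N) Mod tensor_kernel A P N"

text \<open>
  The map \<open>f \<otimes> id\<close> from \<open>P \<otimes> N\<close> to \<open>Q \<otimes> N\<close>. For linear \<open>f\<close> the set passed to
  \<open>the_elem\<close> is a singleton, as \<open>(p, n) \<mapsto> (f p, n)\<close> sends relations to relations.
\<close>

definition tensor_map ::
    "('a, 'm) ring_scheme \<Rightarrow> ('a, 'c, 'l) module_scheme \<Rightarrow> ('a, 'd, 'k) module_scheme \<Rightarrow>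
       ('b \<Rightarrow> 'c) \<Rightarrow> (('b \<times> 'd) \<Rightarrow>\<^sub>0 int) set \<Rightarrow> (('c \<times> 'd) \<Rightarrow>\<^sub>0 int) set" where
  "tensor_map A Q N f X =
     the_elem
       ((\<lambda>z. tensor_kernel A Q N #>\<^bsub>free_Abelian_group (carrier Q \<times> carrier N)\<^esub>
              frag_extend (\<lambda>(x, y). frag_of (f x, y)) z) ` X)"

definition flat_module ::
    "'c itself \<Rightarrow> ('a, 'm) ring_scheme \<Rightarrow> ('a, 'b, 'k) module_scheme \<Rightarrow> bool" where
  "flat_module U A N \<longleftrightarrow>
     module A N \<and>
     (\<forall>(P :: ('a, 'c) module) (Q :: ('a, 'c) module) f.
        module A P \<and> module A Q \<and> f \<in> linear_maps A P Q \<and> inj_on f (carrier P) \<longrightarrow>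
        inj_on (tensor_map A Q N f) (carrier (tensor_product A P N)))"

text \<open>
  \<open>T\<close>-flatness is flatness of the localization over the localized ring, whereas
  \<open>T\<close>-projectivity is projectivity of the localization over the original ring.
\<close>

definition S_flat ::
    "'c itself \<Rightarrow> ('a, 'm) ring_scheme \<Rightarrow> 'a set \<Rightarrow> ('a, 'b, 'k) module_scheme \<Rightarrow> bool" where
  "S_flat U A T N \<longleftrightarrow> flat_module U (localized_ring A T) (localized_module A T N)"

definition S_projective ::
    "'c itself \<Rightarrow> ('a, 'm) ring_scheme \<Rightarrow> 'a set \<Rightarrow> ('a, 'b, 'k) module_scheme \<Rightarrow> bool" where
  "S_projective U A T N \<longleftrightarrow>
     projective_module U A (restrict_scalars (localization_map A T) (localized_module A T N))"


subsection \<open>Components of a module over a product ring\<close>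

definition component_embedding :: "('a, 'm) ring_scheme list \<Rightarrow> nat \<Rightarrow> 'a \<Rightarrow> 'a list" where
  "component_embedding Rs i r = (map ring.zero Rs)[i := r]"

definition component_idempotent :: "('a, 'm) ring_scheme list \<Rightarrow> nat \<Rightarrow> 'a list" where
  "component_idempotent Rs i = component_embedding Rs i \<one>\<^bsub>Rs ! i\<^esub>"

text \<open>
  The submodule \<open>e\<^sub>i M\<close>, on which \<open>r\<close> in the \<open>i\<close>-th factor acts as
  \<open>(0, \<dots>, r, \<dots>, 0)\<close>. Indices start at \<open>0\<close>.
\<close>

definition component_module ::
    "('a, 'm) ring_scheme list \<Rightarrow> nat \<Rightarrow> ('a list, 'b, 'k) module_scheme \<Rightarrow> ('a, 'b) module" where
  "component_module Rs i M =
     \<lparr>carrier = (\<lambda>x. component_idempotent Rs i \<odot>\<^bsub>M\<^esub> x) ` carrier M,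
      monoid.mult = undefined, monoid.one = undefined,
      ring.zero = \<zero>\<^bsub>M\<^esub>, add = add M,
      smult = (\<lambda>r x. component_embedding Rs i r \<odot>\<^bsub>M\<^esub> x)\<rparr>"

end

theory Submission
  imports Defs
begin

text \<open>
  Write \<open>A\<close> for the product ring. Each factor \<open>B\<^sub>i\<close> comes with the projection
  \<open>\<pi>\<^sub>i : A \<rightarrow> B\<^sub>i\<close> and the inclusion \<open>\<iota>\<^sub>i : B\<^sub>i \<rightarrow> A\<close> onto the ideal \<open>e\<^sub>i A\<close>, where \<open>e\<^sub>i = \<iota>\<^sub>i 1\<close>;
  the \<open>e\<^sub>i\<close> are idempotents with sum \<open>1\<close>.

  A \<open>B\<^sub>i\<close>-module becomes an \<open>A\<close>-module along \<open>\<pi>\<^sub>i\<close>, and an \<open>A\<close>-module \<open>P\<close> yields the \<open>B\<^sub>i\<close>-module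
  \<open>e\<^sub>i P\<close>. Neither construction changes the type of the carrier: a lifting or injectivity
  problem over one ring becomes a problem over the other ring within the same universe. Hence projectivity of \<open>N\<close> over \<open>A\<close> passes to \<open>e\<^sub>i N\<close> over \<open>B\<^sub>i\<close>
  (\<open>projective_module_factor\<close>). Conversely, lifts \<open>h\<^sub>i\<close> for the components of a given problem add up to
  a lift \<open>x \<mapsto> \<Sum> h\<^sub>i (e\<^sub>i x)\<close>, because \<open>x = \<Sum> e\<^sub>i x\<close> (\<open>projective_module_if_factors\<close>). Flatness is
  treated in the same way, on representatives in the free abelian group: the relations of
  \<open>P \<otimes> N\<close> over \<open>A\<close> are carried to those of \<open>e\<^sub>i P \<otimes> e\<^sub>i N\<close> over \<open>B\<^sub>i\<close> and back, and
  \<open>x \<otimes> y = \<Sum> e\<^sub>i x \<otimes> e\<^sub>i y\<close> reassembles the components (\<open>flat_module_factor\<close>,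
  \<open>flat_module_if_factors\<close>).

  It remains to see that localization respects factors. If \<open>T\<close> and \<open>T\<^sub>i\<close> are the denominators in \<open>A\<close>
  and \<open>B\<^sub>i\<close>, then \<open>\<pi>\<^sub>i\<close> induces a map of fractions, and so does \<open>\<iota>\<^sub>i\<close> once denominators are sent
  to \<open>T\<close> by \<open>s \<mapsto> (1, \<dots>, s, \<dots>, 1)\<close>. So the ring of fractions of \<open>B\<^sub>i\<close> is a factor of that of \<open>A\<close>, and the
  localization of \<open>e\<^sub>i M\<close> is the corresponding part of the localization of \<open>M\<close>. The flat statement
  uses this over the localized rings, the projective one uses it after restricting scalars to
  \<open>A\<close> and \<open>B\<^sub>i\<close>.
\<close>

section \<open>Modules of fractions\<close>

lemma ring_as_module_simps [simp]:
  "carrier (ring_as_module A) = carrier A" "\<zero>\<^bsub>ring_as_module A\<^esub> = \<zero>\<^bsub>A\<^esub>"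
  "add (ring_as_module A) = add A" "smult (ring_as_module A) = monoid.mult A"
  by (simp_all add: ring_as_module_def)

lemma restrict_scalars_simps [simp]:
  "carrier (restrict_scalars \<phi> N) = carrier N" "\<zero>\<^bsub>restrict_scalars \<phi> N\<^esub> = \<zero>\<^bsub>N\<^esub>"
  "add (restrict_scalars \<phi> N) = add N" "a \<odot>\<^bsub>restrict_scalars \<phi> N\<^esub> x = \<phi> a \<odot>\<^bsub>N\<^esub> x"
  by (simp_all add: restrict_scalars_def)

lemma localized_ring_simps [simp]:
  "carrier (localized_ring A T) = carrier (localized_module A T (ring_as_module A))"
  "\<zero>\<^bsub>localized_ring A T\<^esub> = \<zero>\<^bsub>localized_module A T (ring_as_module A)\<^esub>"
  "add (localized_ring A T) = add (localized_module A T (ring_as_module A))"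
  "monoid.mult (localized_ring A T) = smult (localized_module A T (ring_as_module A))"
  "\<one>\<^bsub>localized_ring A T\<^esub> = localization_map A T \<one>\<^bsub>A\<^esub>"
  by (simp_all add: localized_ring_def localized_module_def localization_map_def)

lemma abelian_group_cong:
  assumes "abelian_group G" "carrier H = carrier G" "add H = add G" "\<zero>\<^bsub>H\<^esub> = \<zero>\<^bsub>G\<^esub>"
  shows "abelian_group H"
  using abelian_groupE[OF assms(1)] assms(2-) by (intro abelian_groupI) simp_all

lemma module_ring_as_module:
  assumes "cring A"
  shows "module A (ring_as_module A)"
proof -
  interpret cring A by fact
  show ?thesis
    by (rule moduleI)
      (auto simp: assms l_distr r_distr m_assoc intro: abelian_group_cong[OF is_abelian_group])
qed

locale module_fractions = module A N for A (structure) and N (structure) +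
  fixes T
  assumes submonoid: "submonoid T A"
begin

lemma denominator_closed [simp]:
  "s \<in> T \<Longrightarrow> s \<in> carrier A" "\<one> \<in> T" "s \<in> T \<Longrightarrow> t \<in> T \<Longrightarrow> s \<otimes> t \<in> T"
  using submonoid.mem_carrier[OF submonoid] submonoid.one_closed[OF submonoid]
    submonoid.m_closed[OF submonoid] by auto

lemma fraction_rel_iff:
  "((m, s), (n, t)) \<in> fraction_rel T N \<longleftrightarrow> m \<in> carrier N \<and> s \<in> T \<and> n \<in> carrier N \<and> t \<in> T \<and>
     (\<exists>u\<in>T. u \<odot>\<^bsub>N\<^esub> (t \<odot>\<^bsub>N\<^esub> m) = u \<odot>\<^bsub>N\<^esub> (s \<odot>\<^bsub>N\<^esub> n))"
  by (simp add: fraction_rel_def)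

lemma equiv_fraction_rel: "equiv (carrier N \<times> T) (fraction_rel T N)"
proof (rule equivI)
  show "fraction_rel T N \<subseteq> (carrier N \<times> T) \<times> carrier N \<times> T"
    by (auto simp: fraction_rel_def)
  show "refl_on (carrier N \<times> T) (fraction_rel T N)"
    by (rule refl_onI) (auto simp: fraction_rel_iff intro: bexI[of _ \<one>])
  show "sym (fraction_rel T N)"
    by (rule symI) (auto simp: fraction_rel_iff; metis)
  show "trans (fraction_rel T N)"
  proof (rule transI)
    fix x y z
    assume xy: "(x, y) \<in> fraction_rel T N" and yz: "(y, z) \<in> fraction_rel T N"
    obtain m s n t p r where [simp]: "x = (m, s)" "y = (n, t)" "z = (p, r)"
      by (metis surj_pair)
    from xy obtain u where u: "u \<in> T" "u \<odot>\<^bsub>N\<^esub> (t \<odot>\<^bsub>N\<^esub> m) = u \<odot>\<^bsub>N\<^esub> (s \<odot>\<^bsub>N\<^esub> n)"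
      and c: "m \<in> carrier N" "s \<in> T" "n \<in> carrier N" "t \<in> T"
      by (auto simp: fraction_rel_iff)
    from yz obtain v where v: "v \<in> T" "v \<odot>\<^bsub>N\<^esub> (r \<odot>\<^bsub>N\<^esub> n) = v \<odot>\<^bsub>N\<^esub> (t \<odot>\<^bsub>N\<^esub> p)"
      and c': "p \<in> carrier N" "r \<in> T"
      by (auto simp: fraction_rel_iff)
    \<comment> \<open>The witness is \<open>u v t\<close>: \<open>u\<close> and \<open>v\<close> come from the given equations, and \<open>t\<close> may be a zero divisor.\<close>
    have "(u \<otimes> v \<otimes> t) \<odot>\<^bsub>N\<^esub> (r \<odot>\<^bsub>N\<^esub> m) = (v \<otimes> r) \<odot>\<^bsub>N\<^esub> (u \<odot>\<^bsub>N\<^esub> (t \<odot>\<^bsub>N\<^esub> m))"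
      using u(1) v(1) c c' by (simp add: smult_assoc1[symmetric] R.m_ac)
    also have "\<dots> = (u \<otimes> s) \<odot>\<^bsub>N\<^esub> (v \<odot>\<^bsub>N\<^esub> (r \<odot>\<^bsub>N\<^esub> n))"
      unfolding u(2) using u(1) v(1) c c' by (simp add: smult_assoc1[symmetric] R.m_ac)
    also have "\<dots> = (u \<otimes> v \<otimes> t) \<odot>\<^bsub>N\<^esub> (s \<odot>\<^bsub>N\<^esub> p)"
      unfolding v(2) using u(1) v(1) c c' by (simp add: smult_assoc1[symmetric] R.m_ac)
    finally show "(x, z) \<in> fraction_rel T N"
      using u(1) v(1) c c' by (auto simp: fraction_rel_iff)
  qed
qed

lemma fraction_eq_iff:
  assumes "m \<in> carrier N" "s \<in> T" "n \<in> carrier N" "t \<in> T"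
  shows "fraction T N m s = fraction T N n t \<longleftrightarrow>
    (\<exists>u\<in>T. u \<odot>\<^bsub>N\<^esub> (t \<odot>\<^bsub>N\<^esub> m) = u \<odot>\<^bsub>N\<^esub> (s \<odot>\<^bsub>N\<^esub> n))"
  unfolding fraction_def using assms eq_equiv_class_iff[OF equiv_fraction_rel, of "(m, s)" "(n, t)"]
  by (simp add: fraction_rel_iff)

lemma fraction_eqI:
  assumes "m \<in> carrier N" "s \<in> T" "n \<in> carrier N" "t \<in> T" "t \<odot>\<^bsub>N\<^esub> m = s \<odot>\<^bsub>N\<^esub> n"
  shows "fraction T N m s = fraction T N n t"
  using assms by (auto simp: fraction_eq_iff intro: bexI[of _ \<one>])

lemma mem_fraction_iff:
  assumes "m \<in> carrier N" "s \<in> T"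
  shows "(n, t) \<in> fraction T N m s \<longleftrightarrow>
    n \<in> carrier N \<and> t \<in> T \<and> fraction T N n t = fraction T N m s"
  using assms fraction_eq_iff[of m s n t] by (auto simp: fraction_def fraction_rel_iff)

text \<open>
  Operations on fractions are unions over representatives; such a union collapses as soon as its
  members do not depend on the representative.
\<close>

lemma UN_fraction:
  assumes "m \<in> carrier N" "s \<in> T"
    and "\<And>n t. \<lbrakk>n \<in> carrier N; t \<in> T; fraction T N n t = fraction T N m s\<rbrakk> \<Longrightarrow> g n t = C"
  shows "(\<Union>(n, t)\<in>fraction T N m s. g n t) = C"
proof -
  have "(\<Union>(n, t)\<in>fraction T N m s. g n t) = (\<Union>(n, t)\<in>fraction T N m s. C)"
    using assms by (intro SUP_cong) (auto simp: mem_fraction_iff)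
  moreover have "(m, s) \<in> fraction T N m s"
    using assms by (simp add: mem_fraction_iff)
  ultimately show ?thesis by auto
qed

lemma carrier_localized_module:
  "carrier (localized_module A T N) = (\<lambda>(m, s). fraction T N m s) ` (carrier N \<times> T)"
  by (auto simp: localized_module_def quotient_def fraction_def)

lemma fraction_closed [simp]:
  "\<lbrakk>m \<in> carrier N; s \<in> T\<rbrakk> \<Longrightarrow> fraction T N m s \<in> carrier (localized_module A T N)"
  by (auto simp: carrier_localized_module)

lemma fractionE:
  assumes "x \<in> carrier (localized_module A T N)"
  obtains m s where "m \<in> carrier N" "s \<in> T" "x = fraction T N m s"
  using assms by (auto simp: carrier_localized_module)

lemma zero_localized_module: "\<zero>\<^bsub>localized_module A T N\<^esub> = fraction T N \<zero>\<^bsub>N\<^esub> \<one>"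
  by (simp add: localized_module_def)

lemma add_fractions [simp]:
  assumes "m \<in> carrier N" "s \<in> T" "n \<in> carrier N" "t \<in> T"
  shows "fraction T N m s \<oplus>\<^bsub>localized_module A T N\<^esub> fraction T N n t =
    fraction T N (t \<odot>\<^bsub>N\<^esub> m \<oplus>\<^bsub>N\<^esub> s \<odot>\<^bsub>N\<^esub> n) (s \<otimes> t)"
proof -
  have representatives: "fraction T N (t' \<odot>\<^bsub>N\<^esub> m' \<oplus>\<^bsub>N\<^esub> s' \<odot>\<^bsub>N\<^esub> n') (s' \<otimes> t') =
      fraction T N (t \<odot>\<^bsub>N\<^esub> m \<oplus>\<^bsub>N\<^esub> s \<odot>\<^bsub>N\<^esub> n) (s \<otimes> t)"
    if c: "m' \<in> carrier N" "s' \<in> T" "n' \<in> carrier N" "t' \<in> T"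
      and eq: "fraction T N m' s' = fraction T N m s" "fraction T N n' t' = fraction T N n t"
    for m' s' n' t'
  proof -
    from eq(1) c assms obtain u
      where u: "u \<in> T" "u \<odot>\<^bsub>N\<^esub> (s \<odot>\<^bsub>N\<^esub> m') = u \<odot>\<^bsub>N\<^esub> (s' \<odot>\<^bsub>N\<^esub> m)"
      by (auto simp: fraction_eq_iff)
    from eq(2) c assms obtain v
      where v: "v \<in> T" "v \<odot>\<^bsub>N\<^esub> (t \<odot>\<^bsub>N\<^esub> n') = v \<odot>\<^bsub>N\<^esub> (t' \<odot>\<^bsub>N\<^esub> n)"
      by (auto simp: fraction_eq_iff)
    have "(u \<otimes> v) \<odot>\<^bsub>N\<^esub> ((s \<otimes> t) \<odot>\<^bsub>N\<^esub> (t' \<odot>\<^bsub>N\<^esub> m' \<oplus>\<^bsub>N\<^esub> s' \<odot>\<^bsub>N\<^esub> n')) =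
        (v \<otimes> t \<otimes> t') \<odot>\<^bsub>N\<^esub> (u \<odot>\<^bsub>N\<^esub> (s \<odot>\<^bsub>N\<^esub> m')) \<oplus>\<^bsub>N\<^esub>
        (u \<otimes> s \<otimes> s') \<odot>\<^bsub>N\<^esub> (v \<odot>\<^bsub>N\<^esub> (t \<odot>\<^bsub>N\<^esub> n'))"
      using u(1) v(1) c assms by (simp add: smult_assoc1[symmetric] smult_r_distr R.m_ac)
    also have "\<dots> = (u \<otimes> v) \<odot>\<^bsub>N\<^esub> ((s' \<otimes> t') \<odot>\<^bsub>N\<^esub> (t \<odot>\<^bsub>N\<^esub> m \<oplus>\<^bsub>N\<^esub> s \<odot>\<^bsub>N\<^esub> n))"
      unfolding u(2) v(2)
      using u(1) v(1) c assms by (simp add: smult_assoc1[symmetric] smult_r_distr R.m_ac)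
    finally show ?thesis
      using u(1) v(1) c assms by (subst fraction_eq_iff) (auto intro!: bexI[of _ "u \<otimes> v"])
  qed
  have "add (localized_module A T N) = fraction_add A T N"
    by (simp add: localized_module_def)
  then show ?thesis
    unfolding fraction_add_def
    by (elim ssubst)
      (rule UN_fraction[OF assms(1,2)], rule UN_fraction[OF assms(3,4)], rule representatives)
qed

lemma smult_fractions [simp]:
  assumes a: "a \<in> carrier A" "s \<in> T" and n: "n \<in> carrier N" "t \<in> T"
  shows "fraction T (ring_as_module A) a s \<odot>\<^bsub>localized_module A T N\<^esub> fraction T N n t =
    fraction T N (a \<odot>\<^bsub>N\<^esub> n) (s \<otimes> t)"
proof -
  interpret R: module_fractions A "ring_as_module A" T
    by (intro module_fractions.intro module_ring_as_module R.is_cring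
        module_fractions_axioms.intro submonoid)
  have representatives: "fraction T N (a' \<odot>\<^bsub>N\<^esub> n') (s' \<otimes> t') = fraction T N (a \<odot>\<^bsub>N\<^esub> n) (s \<otimes> t)"
    if c: "a' \<in> carrier A" "s' \<in> T" "n' \<in> carrier N" "t' \<in> T"
      and eq: "fraction T (ring_as_module A) a' s' = fraction T (ring_as_module A) a s"
        "fraction T N n' t' = fraction T N n t"
    for a' s' n' t'
  proof -
    from eq(1) c a obtain u where u: "u \<in> T" "u \<otimes> (s \<otimes> a') = u \<otimes> (s' \<otimes> a)"
      using R.fraction_eq_iff[of a' s' a s] by auto
    from eq(2) c n obtain v
      where v: "v \<in> T" "v \<odot>\<^bsub>N\<^esub> (t \<odot>\<^bsub>N\<^esub> n') = v \<odot>\<^bsub>N\<^esub> (t' \<odot>\<^bsub>N\<^esub> n)"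
      by (auto simp: fraction_eq_iff)
    have "(u \<otimes> v) \<odot>\<^bsub>N\<^esub> ((s \<otimes> t) \<odot>\<^bsub>N\<^esub> (a' \<odot>\<^bsub>N\<^esub> n')) =
        (u \<otimes> (s \<otimes> a')) \<odot>\<^bsub>N\<^esub> (v \<odot>\<^bsub>N\<^esub> (t \<odot>\<^bsub>N\<^esub> n'))"
      using u(1) v(1) c a n by (simp add: smult_assoc1[symmetric] R.m_ac)
    also have "\<dots> = (u \<otimes> v) \<odot>\<^bsub>N\<^esub> ((s' \<otimes> t') \<odot>\<^bsub>N\<^esub> (a \<odot>\<^bsub>N\<^esub> n))"
      unfolding u(2) v(2) using u(1) v(1) c a n by (simp add: smult_assoc1[symmetric] R.m_ac)
    finally show ?thesis
      using u(1) v(1) c a n by (subst fraction_eq_iff) (auto intro!: bexI[of _ "u \<otimes> v"])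
  qed
  have "smult (localized_module A T N) = fraction_smult A T N"
    by (simp add: localized_module_def)
  then show ?thesis
    unfolding fraction_smult_def
    by (elim ssubst)
      (rule R.UN_fraction[simplified, OF a], rule UN_fraction[OF n], rule representatives)
qed

lemma abelian_group_localized_module: "abelian_group (localized_module A T N)"
proof (rule abelian_groupI)
  fix x y z
  assume "x \<in> carrier (localized_module A T N)" "y \<in> carrier (localized_module A T N)"
  then show "x \<oplus>\<^bsub>localized_module A T N\<^esub> y \<in> carrier (localized_module A T N)"
    by (elim fractionE) simp
  assume "z \<in> carrier (localized_module A T N)"
  with \<open>x \<in> _\<close> \<open>y \<in> _\<close>
  show "x \<oplus>\<^bsub>localized_module A T N\<^esub> y \<oplus>\<^bsub>localized_module A T N\<^esub> z =
      x \<oplus>\<^bsub>localized_module A T N\<^esub> (y \<oplus>\<^bsub>localized_module A T N\<^esub> z)"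
    by (elim fractionE, simp, intro fraction_eqI)
      (simp_all add: smult_r_distr smult_assoc1[symmetric] R.m_ac M.a_ac)
next
  fix x y
  assume "x \<in> carrier (localized_module A T N)" "y \<in> carrier (localized_module A T N)"
  then show "x \<oplus>\<^bsub>localized_module A T N\<^esub> y = y \<oplus>\<^bsub>localized_module A T N\<^esub> x"
    by (elim fractionE, simp, intro fraction_eqI)
      (simp_all add: smult_r_distr smult_assoc1[symmetric] R.m_ac M.a_ac)
next
  show "\<zero>\<^bsub>localized_module A T N\<^esub> \<in> carrier (localized_module A T N)"
    by (simp add: zero_localized_module)
next
  fix x
  assume "x \<in> carrier (localized_module A T N)"
  then show "\<zero>\<^bsub>localized_module A T N\<^esub> \<oplus>\<^bsub>localized_module A T N\<^esub> x = x"
    by (elim fractionE) (simp add: zero_localized_module)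
next
  fix x
  assume "x \<in> carrier (localized_module A T N)"
  then obtain m s where x: "m \<in> carrier N" "s \<in> T" "x = fraction T N m s"
    by (elim fractionE)
  have "fraction T N (\<ominus>\<^bsub>N\<^esub> m) s \<oplus>\<^bsub>localized_module A T N\<^esub> x = \<zero>\<^bsub>localized_module A T N\<^esub>"
    using x by (simp add: zero_localized_module smult_r_minus M.l_neg)
      (intro fraction_eqI; simp add: smult_r_minus M.l_neg)
  then show "\<exists>y\<in>carrier (localized_module A T N).
      y \<oplus>\<^bsub>localized_module A T N\<^esub> x = \<zero>\<^bsub>localized_module A T N\<^esub>"
    using x by (intro bexI[of _ "fraction T N (\<ominus>\<^bsub>N\<^esub> m) s"]) auto
qed

end

text \<open>
  The localized ring is the localization of \<open>A\<close> as a module over itself, with scalar multiplication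
  as its product. The computation with fractions of a module therefore covers it.
\<close>

lemma cring_localized_ring:
  assumes "cring A" "submonoid T A"
  shows "cring (localized_ring A T)"
proof -
  interpret module_fractions A "ring_as_module A" T
    using assms by (intro module_fractions.intro module_ring_as_module module_fractions_axioms.intro)
  note [simp] = smult_fractions[simplified] add_fractions[simplified] fraction_closed[simplified]
  show ?thesis
  proof (rule cringI)
    show "abelian_group (localized_ring A T)"
      by (rule abelian_group_cong[OF abelian_group_localized_module]) simp_all
    show "comm_monoid (localized_ring A T)"
    proof (rule comm_monoidI, goal_cases)
      case (1 x y)
      then show ?case by simp (elim fractionE; simp)
    next
      case 2
      show ?case by (simp add: localization_map_def)
    next
      case (3 x y z)
      then show ?case by simp (elim fractionE; simp add: R.m_assoc)
    next
      case (4 x)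
      then show ?case by (simp add: localization_map_def) (elim fractionE; simp)
    next
      case (5 x y)
      then show ?case by simp (elim fractionE; simp add: R.m_comm)
    qed
    fix x y z
    assume "x \<in> carrier (localized_ring A T)" "y \<in> carrier (localized_ring A T)"
      "z \<in> carrier (localized_ring A T)"
    then show "(x \<oplus>\<^bsub>localized_ring A T\<^esub> y) \<otimes>\<^bsub>localized_ring A T\<^esub> z =
       x \<otimes>\<^bsub>localized_ring A T\<^esub> z \<oplus>\<^bsub>localized_ring A T\<^esub> y \<otimes>\<^bsub>localized_ring A T\<^esub> z"
      by simp (elim fractionE, simp, intro fraction_eqI; simp add: R.l_distr R.r_distr R.m_ac)
  qed
qed

context module_fractions
begin

lemma module_localized_module: "module (localized_ring A T) (localized_module A T N)"
proof -
  interpret R: module_fractions A "ring_as_module A" T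
    by (intro module_fractions.intro module_ring_as_module R.is_cring
        module_fractions_axioms.intro submonoid)
  note [simp] = R.smult_fractions[simplified] R.add_fractions[simplified] R.fraction_closed[simplified]
  show ?thesis
  proof (rule moduleI, goal_cases)
    case 1
    show ?case by (intro cring_localized_ring R.is_cring submonoid)
  next
    case 2
    show ?case by (rule abelian_group_localized_module)
  next
    case (3 a x)
    then show ?case by simp (elim fractionE R.fractionE; simp)
  next
    case (4 a b x)
    then show ?case by simp (elim fractionE R.fractionE, simp, intro fraction_eqI;
        simp add: smult_l_distr smult_r_distr smult_assoc1[symmetric] R.m_ac)
  next
    case (5 a x y)
    then show ?case by simp (elim fractionE R.fractionE, simp, intro fraction_eqI;
        simp add: smult_r_distr smult_assoc1[symmetric] R.m_ac)
  next
    case (6 a b x)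
    then show ?case by simp (elim fractionE R.fractionE; simp add: smult_assoc1 R.m_assoc)
  next
    case (7 x)
    then show ?case by (simp add: localization_map_def) (elim fractionE; simp)
  qed
qed

end

lemma localization_map_ring_hom:
  assumes "cring A" "submonoid T A"
  shows "localization_map A T \<in> ring_hom A (localized_ring A T)"
proof -
  interpret module_fractions A "ring_as_module A" T
    using assms by (intro module_fractions.intro module_ring_as_module module_fractions_axioms.intro)
  show ?thesis
    by (rule ring_hom_memI)
     (simp_all add: localization_map_def fraction_closed[simplified] smult_fractions[simplified]
       add_fractions[simplified])
qed

lemma module_restrict_scalars:
  assumes "cring A" "\<phi> \<in> ring_hom A B" "module B N"
  shows "module A (restrict_scalars \<phi> N)"
proof -
  interpret module B N by fact
  show ?thesis
    using assms(2) by (intro moduleI assms(1) abelian_group_cong[OF M.abelian_group_axioms])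
      (simp_all add: ring_hom_closed ring_hom_add ring_hom_mult ring_hom_one
        smult_l_distr smult_r_distr smult_assoc1)
qed

section \<open>Direct factors of rings and modules\<close>

text \<open>
  \<open>B\<close> is a direct factor of \<open>A\<close>: the map \<open>\<iota>\<close> identifies \<open>B\<close> with the ideal generated by the
  idempotent \<open>e = \<iota> 1\<close>. It respects sums and products, but it is not a ring homomorphism, since
  \<open>e\<close> need not be \<open>1\<close>.
\<close>

locale ring_factor = A: cring A + B: cring B
  for A :: "('a, 'm) ring_scheme" and B :: "('b, 'n) ring_scheme" +
  fixes \<pi> :: "'a \<Rightarrow> 'b" and \<iota> :: "'b \<Rightarrow> 'a"
  assumes proj_hom: "\<pi> \<in> ring_hom A B"
    and incl_closed [simp]: "b \<in> carrier B \<Longrightarrow> \<iota> b \<in> carrier A"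
    and incl_add: "\<lbrakk>b \<in> carrier B; c \<in> carrier B\<rbrakk> \<Longrightarrow> \<iota> (b \<oplus>\<^bsub>B\<^esub> c) = \<iota> b \<oplus>\<^bsub>A\<^esub> \<iota> c"
    and incl_mult: "\<lbrakk>b \<in> carrier B; c \<in> carrier B\<rbrakk> \<Longrightarrow> \<iota> (b \<otimes>\<^bsub>B\<^esub> c) = \<iota> b \<otimes>\<^bsub>A\<^esub> \<iota> c"
    and proj_incl [simp]: "b \<in> carrier B \<Longrightarrow> \<pi> (\<iota> b) = b"
    and incl_proj: "a \<in> carrier A \<Longrightarrow> \<iota> (\<pi> a) = \<iota> \<one>\<^bsub>B\<^esub> \<otimes>\<^bsub>A\<^esub> a"
begin

lemma proj_closed [simp]: "a \<in> carrier A \<Longrightarrow> \<pi> a \<in> carrier B"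
  by (rule ring_hom_closed[OF proj_hom])

lemma incl_eq: "b \<in> carrier B \<Longrightarrow> \<iota> b = \<iota> \<one>\<^bsub>B\<^esub> \<otimes>\<^bsub>A\<^esub> \<iota> b"
  using incl_mult[of "\<one>\<^bsub>B\<^esub>" b] by simp

end

text \<open>
  Likewise \<open>j\<close> identifies the \<open>B\<close>-module \<open>N'\<close> with \<open>e N\<close>, and \<open>p\<close> is the projection \<open>x \<mapsto> e x\<close>. Asking
  for maps rather than \<open>N' = e N\<close> lets \<open>N'\<close> be a \<open>B\<close>-module with \<open>A\<close> acting through \<open>\<pi>\<close>, or the
  localization of a component, which consists of fractions of another type.
\<close>

locale module_factor = ring_factor A B \<pi> \<iota> + N: module A N + N': module B N'
  for A :: "('a, 'm) ring_scheme" and B :: "('b, 'n) ring_scheme" and \<pi> \<iota>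
    and N :: "('a, 'c, 'k) module_scheme" and N' :: "('b, 'd, 'l) module_scheme" +
  fixes p :: "'c \<Rightarrow> 'd" and j :: "'d \<Rightarrow> 'c"
  assumes p_closed [simp]: "x \<in> carrier N \<Longrightarrow> p x \<in> carrier N'"
    and p_add: "\<lbrakk>x \<in> carrier N; y \<in> carrier N\<rbrakk> \<Longrightarrow> p (x \<oplus>\<^bsub>N\<^esub> y) = p x \<oplus>\<^bsub>N'\<^esub> p y"
    and p_smult: "\<lbrakk>a \<in> carrier A; x \<in> carrier N\<rbrakk> \<Longrightarrow> p (a \<odot>\<^bsub>N\<^esub> x) = \<pi> a \<odot>\<^bsub>N'\<^esub> p x"
    and j_closed [simp]: "v \<in> carrier N' \<Longrightarrow> j v \<in> carrier N"
    and j_add: "\<lbrakk>v \<in> carrier N'; w \<in> carrier N'\<rbrakk> \<Longrightarrow> j (v \<oplus>\<^bsub>N'\<^esub> w) = j v \<oplus>\<^bsub>N\<^esub> j w"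
    and j_smult: "\<lbrakk>b \<in> carrier B; v \<in> carrier N'\<rbrakk> \<Longrightarrow> j (b \<odot>\<^bsub>N'\<^esub> v) = \<iota> b \<odot>\<^bsub>N\<^esub> j v"
    and p_j [simp]: "v \<in> carrier N' \<Longrightarrow> p (j v) = v"
    and j_p: "x \<in> carrier N \<Longrightarrow> j (p x) = \<iota> \<one>\<^bsub>B\<^esub> \<odot>\<^bsub>N\<^esub> x"
begin

lemma unit_smult_j: "y \<in> carrier N' \<Longrightarrow> \<iota> \<one>\<^bsub>B\<^esub> \<odot>\<^bsub>N\<^esub> j y = j y"
  using j_p[of "j y"] by simp

end

text \<open>
  For a product ring this is the component module of the statement; an arbitrary factor is needed
  for test modules over a localized ring.
\<close>

definition factor_module ::
    "('b, 'n) ring_scheme \<Rightarrow> ('b \<Rightarrow> 'a) \<Rightarrow> ('a, 'c, 'k) module_scheme \<Rightarrow> ('b, 'c) module" where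
  "factor_module B \<iota> P =
     \<lparr>carrier = (\<lambda>x. \<iota> \<one>\<^bsub>B\<^esub> \<odot>\<^bsub>P\<^esub> x) ` carrier P,
      monoid.mult = undefined, monoid.one = undefined,
      ring.zero = \<zero>\<^bsub>P\<^esub>, add = add P, smult = (\<lambda>b x. \<iota> b \<odot>\<^bsub>P\<^esub> x)\<rparr>"

lemma factor_module_simps [simp]:
  "carrier (factor_module B \<iota> P) = (\<lambda>x. \<iota> \<one>\<^bsub>B\<^esub> \<odot>\<^bsub>P\<^esub> x) ` carrier P"
  "\<zero>\<^bsub>factor_module B \<iota> P\<^esub> = \<zero>\<^bsub>P\<^esub>" "add (factor_module B \<iota> P) = add P"
  "b \<odot>\<^bsub>factor_module B \<iota> P\<^esub> x = \<iota> b \<odot>\<^bsub>P\<^esub> x"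
  by (simp_all add: factor_module_def)

context ring_factor
begin

text \<open>
  With \<open>A\<close> acting through \<open>\<pi>\<close>, the idempotent \<open>e\<close> acts as \<open>\<pi> e = 1\<close>, so the module is its own
  \<open>B\<close>-part.
\<close>

lemma module_factor_restrict_scalars:
  assumes "module B P"
  shows "module_factor A B \<pi> \<iota> (restrict_scalars \<pi> P) P (\<lambda>x. x) (\<lambda>x. x)"
proof -
  interpret P: module B P by fact
  interpret P': module A "restrict_scalars \<pi> P"
    by (rule module_restrict_scalars[OF A.is_cring proj_hom assms])
  show ?thesis
    by unfold_locales simp_all
qed

lemma module_factor_factor_module:
  assumes "module A P"
  shows "module_factor A B \<pi> \<iota> P (factor_module B \<iota> P) (\<lambda>x. \<iota> \<one>\<^bsub>B\<^esub> \<odot>\<^bsub>P\<^esub> x) (\<lambda>x. x)"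
proof -
  interpret P: module A P by fact
  define e where "e = \<iota> \<one>\<^bsub>B\<^esub>"
  have e [simp]: "e \<in> carrier A" "\<iota> \<one>\<^bsub>B\<^esub> = e" "e \<otimes>\<^bsub>A\<^esub> e = e"
    using incl_eq[of "\<one>\<^bsub>B\<^esub>"] by (simp_all add: e_def)
  have fix_iff: "x \<in> (\<lambda>x. e \<odot>\<^bsub>P\<^esub> x) ` carrier P \<longleftrightarrow> x \<in> carrier P \<and> e \<odot>\<^bsub>P\<^esub> x = x" for x
    by (auto simp: P.smult_assoc1[symmetric] intro: image_eqI[of _ _ x])
  have incl_e: "e \<otimes>\<^bsub>A\<^esub> \<iota> b = \<iota> b" if "b \<in> carrier B" for b
    using incl_eq[OF that] by simp
  have "module B (factor_module B \<iota> P)"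
  proof (rule moduleI)
    show "abelian_group (factor_module B \<iota> P)"
    proof (rule abelian_groupI)
      fix x
      assume "x \<in> carrier (factor_module B \<iota> P)"
      then show "\<exists>y\<in>carrier (factor_module B \<iota> P).
          y \<oplus>\<^bsub>factor_module B \<iota> P\<^esub> x = \<zero>\<^bsub>factor_module B \<iota> P\<^esub>"
        by (intro bexI[of _ "\<ominus>\<^bsub>P\<^esub> x"]) (simp_all add: fix_iff P.smult_r_minus P.M.l_neg)
    qed (simp_all add: fix_iff P.M.a_ac P.smult_r_distr)
  qed (simp_all add: fix_iff B.is_cring incl_add incl_mult P.smult_l_distr P.smult_r_distr
      incl_e flip: P.smult_assoc1)
  then interpret P': module B "factor_module B \<iota> P" .
  have "\<iota> (\<pi> a) \<otimes>\<^bsub>A\<^esub> e = e \<otimes>\<^bsub>A\<^esub> a" if "a \<in> carrier A" for a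
    using incl_proj[OF that] incl_e[of "\<pi> a"] that A.m_comm[of e "\<iota> (\<pi> a)"] by simp
  then show ?thesis
    by unfold_locales (simp_all add: fix_iff P.smult_r_distr flip: P.smult_assoc1)
qed

end

text \<open>
  Factors of modules survive restriction of scalars along compatible homomorphisms into the two
  rings, because \<open>\<phi>\<close> sends the unit of the small factor to that of the large one. This passes from
  the localized rings back to the original ones.
\<close>

lemma module_factor_restrict_along:
  assumes "module_factor A B \<pi> \<iota> N N' p j" and "ring_factor C D \<pi>' \<iota>'"
    and "\<phi> \<in> ring_hom C A" and "\<psi> \<in> ring_hom D B"
    and proj: "\<And>c. c \<in> carrier C \<Longrightarrow> \<pi> (\<phi> c) = \<psi> (\<pi>' c)"
    and incl: "\<And>d. d \<in> carrier D \<Longrightarrow> \<iota> (\<psi> d) = \<phi> (\<iota>' d)"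
  shows "module_factor C D \<pi>' \<iota>' (restrict_scalars \<phi> N) (restrict_scalars \<psi> N') p j"
proof -
  interpret module_factor A B \<pi> \<iota> N N' p j by fact
  interpret C: ring_factor C D \<pi>' \<iota>' by fact
  interpret M: module C "restrict_scalars \<phi> N"
    by (rule module_restrict_scalars[OF C.A.is_cring assms(3) N.module_axioms])
  interpret M': module D "restrict_scalars \<psi> N'"
    by (rule module_restrict_scalars[OF C.B.is_cring assms(4) N'.module_axioms])
  show ?thesis
    using ring_hom_closed[OF assms(3)] ring_hom_closed[OF assms(4)] ring_hom_one[OF assms(4)]
      incl[OF C.B.one_closed]
    by unfold_locales (simp_all add: p_add p_smult j_add j_smult proj incl j_p)
qed

section \<open>Projectivity and direct factors\<close>

lemma linear_mapsD:
  assumes "f \<in> linear_maps A M N"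
  shows "x \<in> carrier M \<Longrightarrow> f x \<in> carrier N"
    and "\<lbrakk>x \<in> carrier M; y \<in> carrier M\<rbrakk> \<Longrightarrow> f (x \<oplus>\<^bsub>M\<^esub> y) = f x \<oplus>\<^bsub>N\<^esub> f y"
    and "\<lbrakk>a \<in> carrier A; x \<in> carrier M\<rbrakk> \<Longrightarrow> f (a \<odot>\<^bsub>M\<^esub> x) = a \<odot>\<^bsub>N\<^esub> f x"
  using assms by (auto simp: linear_maps_def)

lemma linear_mapsI:
  assumes "\<And>x. x \<in> carrier M \<Longrightarrow> f x \<in> carrier N"
    and "\<And>x y. \<lbrakk>x \<in> carrier M; y \<in> carrier M\<rbrakk> \<Longrightarrow> f (x \<oplus>\<^bsub>M\<^esub> y) = f x \<oplus>\<^bsub>N\<^esub> f y"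
    and "\<And>a x. \<lbrakk>a \<in> carrier A; x \<in> carrier M\<rbrakk> \<Longrightarrow> f (a \<odot>\<^bsub>M\<^esub> x) = a \<odot>\<^bsub>N\<^esub> f x"
  shows "f \<in> linear_maps A M N"
  using assms by (auto simp: linear_maps_def)

lemma linear_map_to_factor:
  assumes "module_factor A B \<pi> \<iota> M M' p j" "module_factor A B \<pi> \<iota> N N' q k"
    and f: "f \<in> linear_maps A M N"
  shows "(\<lambda>x. q (f (j x))) \<in> linear_maps B M' N'"
proof -
  interpret M: module_factor A B \<pi> \<iota> M M' p j by fact
  interpret N: module_factor A B \<pi> \<iota> N N' q k by fact
  show ?thesis
    by (rule linear_mapsI)
      (simp_all add: linear_mapsD[OF f] M.j_add M.j_smult N.p_add N.p_smult)
qed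

text \<open>
  \<open>A\<close>-linearity holds because the values lie in \<open>e N\<close>, where \<open>a\<close> and \<open>\<iota> (\<pi> a) = e a\<close> act alike.
\<close>

lemma linear_map_from_factor:
  assumes "module_factor A B \<pi> \<iota> M M' p j" "module_factor A B \<pi> \<iota> N N' q k"
    and f: "f \<in> linear_maps B M' N'"
  shows "(\<lambda>x. k (f (p x))) \<in> linear_maps A M N"
proof -
  interpret M: module_factor A B \<pi> \<iota> M M' p j by fact
  interpret N: module_factor A B \<pi> \<iota> N N' q k by fact
  show ?thesis
  proof (rule linear_mapsI)
    fix a x
    assume a: "a \<in> carrier A" and x: "x \<in> carrier M"
    have "k (f (p (a \<odot>\<^bsub>M\<^esub> x))) = \<iota> (\<pi> a) \<odot>\<^bsub>N\<^esub> k (f (p x))"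
      using a x by (simp add: M.p_smult linear_mapsD[OF f] N.j_smult)
    also have "\<dots> = (a \<otimes>\<^bsub>A\<^esub> \<iota> \<one>\<^bsub>B\<^esub>) \<odot>\<^bsub>N\<^esub> k (f (p x))"
      using a by (simp add: M.incl_proj M.A.m_comm)
    also have "\<dots> = a \<odot>\<^bsub>N\<^esub> k (f (p x))"
      using a x by (simp add: N.N.smult_assoc1 N.unit_smult_j linear_mapsD[OF f])
    finally show "k (f (p (a \<odot>\<^bsub>M\<^esub> x))) = a \<odot>\<^bsub>N\<^esub> k (f (p x))" .
  qed (simp_all add: linear_mapsD[OF f] M.p_add N.j_add)
qed

text \<open>
  A lifting problem over \<open>B\<close> is one over \<open>A\<close> with \<open>A\<close> acting through \<open>\<pi>\<close>; a solution for \<open>N\<close>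
  restricts along \<open>j\<close>.
\<close>

lemma projective_module_factor:
  fixes A :: "('a, 'm) ring_scheme" and B :: "('b, 'n) ring_scheme"
  assumes factor: "module_factor A B \<pi> \<iota> N N' p j"
    and proj: "projective_module TYPE('u) A N"
  shows "projective_module TYPE('u) B N'"
  unfolding projective_module_def
proof (intro conjI allI impI)
  interpret module_factor A B \<pi> \<iota> N N' p j by fact
  show "module B N'" by (rule N'.module_axioms)
  fix P Q :: "('b, 'u) module" and g f
  assume "module B P \<and> module B Q \<and> g \<in> linear_maps B P Q \<and>
      g ` carrier P = carrier Q \<and> f \<in> linear_maps B N' Q"
  then have P: "module B P" and Q: "module B Q" and g: "g \<in> linear_maps B P Q"
    and surj: "g ` carrier P = carrier Q" and f: "f \<in> linear_maps B N' Q"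
    by auto
  let ?P = "restrict_scalars \<pi> P" and ?Q = "restrict_scalars \<pi> Q"
  note FP = module_factor_restrict_scalars[OF P] and FQ = module_factor_restrict_scalars[OF Q]
  have "module A ?P" "module A ?Q"
    using module_restrict_scalars[OF A.is_cring proj_hom] P Q by auto
  moreover have "g \<in> linear_maps A ?P ?Q"
    using linear_map_from_factor[OF FP FQ g] .
  moreover have "g ` carrier ?P = carrier ?Q"
    using surj by simp
  moreover have "(\<lambda>x. f (p x)) \<in> linear_maps A N ?Q"
    using linear_map_from_factor[OF factor FQ f] .
  ultimately obtain h where h: "h \<in> linear_maps A N ?P"
    and lift: "\<And>x. x \<in> carrier N \<Longrightarrow> g (h x) = f (p x)"
    using proj unfolding projective_module_def by blast
  have "(\<lambda>x. h (j x)) \<in> linear_maps B N' P"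
    using linear_map_to_factor[OF factor FP h] .
  moreover have "\<forall>x\<in>carrier N'. g (h (j x)) = f x"
    using lift by simp
  ultimately show "\<exists>h\<in>linear_maps B N' P. \<forall>x\<in>carrier N'. g (h x) = f x"
    by (intro bexI[of _ "\<lambda>x. h (j x)"])
qed

lemma (in module) finsum_smult_rdistr:
  assumes "finite I" "a \<in> I \<rightarrow> carrier R" "x \<in> carrier M"
  shows "(\<Oplus>\<^bsub>R\<^esub>i\<in>I. a i) \<odot>\<^bsub>M\<^esub> x = (\<Oplus>\<^bsub>M\<^esub>i\<in>I. a i \<odot>\<^bsub>M\<^esub> x)"
  using assms by (induction I) (auto simp: Pi_def smult_l_distr)

lemma linear_map_zero:
  assumes "module A M" "module A N" "f \<in> linear_maps A M N"
  shows "f \<zero>\<^bsub>M\<^esub> = \<zero>\<^bsub>N\<^esub>"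
proof -
  interpret M: module A M by fact
  interpret N: module A N by fact
  show ?thesis
    using linear_mapsD(1)[OF assms(3), of "\<zero>\<^bsub>M\<^esub>"] linear_mapsD(3)[OF assms(3), of "\<zero>\<^bsub>A\<^esub>" "\<zero>\<^bsub>M\<^esub>"]
    by simp
qed

lemma linear_map_finsum:
  assumes "module A M" "module A N" "f \<in> linear_maps A M N" "finite I" "x \<in> I \<rightarrow> carrier M"
  shows "f (\<Oplus>\<^bsub>M\<^esub>i\<in>I. x i) = (\<Oplus>\<^bsub>N\<^esub>i\<in>I. f (x i))"
proof -
  interpret M: module A M by fact
  interpret N: module A N by fact
  show ?thesis
    using assms(4,5)
    by (induction I)
      (auto simp: linear_map_zero[OF assms(1-3)] Pi_def linear_mapsD[OF assms(3)])
qed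

lemma linear_map_sum_of_maps:
  assumes "module A M" "module A N" "finite I" "\<And>i. i \<in> I \<Longrightarrow> f i \<in> linear_maps A M N"
  shows "(\<lambda>x. \<Oplus>\<^bsub>N\<^esub>i\<in>I. f i x) \<in> linear_maps A M N"
proof -
  interpret M: module A M by fact
  interpret N: module A N by fact
  show ?thesis
  proof (rule linear_mapsI)
    fix x y
    assume xy: "x \<in> carrier M" "y \<in> carrier M"
    have "(\<Oplus>\<^bsub>N\<^esub>i\<in>I. f i (x \<oplus>\<^bsub>M\<^esub> y)) = (\<Oplus>\<^bsub>N\<^esub>i\<in>I. f i x \<oplus>\<^bsub>N\<^esub> f i y)"
      using linear_mapsD[OF assms(4)] xy by (intro N.finsum_cong') auto
    also have "\<dots> = (\<Oplus>\<^bsub>N\<^esub>i\<in>I. f i x) \<oplus>\<^bsub>N\<^esub> (\<Oplus>\<^bsub>N\<^esub>i\<in>I. f i y)"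
      using linear_mapsD[OF assms(4)] xy by (intro N.finsum_addf) auto
    finally show "(\<Oplus>\<^bsub>N\<^esub>i\<in>I. f i (x \<oplus>\<^bsub>M\<^esub> y)) = (\<Oplus>\<^bsub>N\<^esub>i\<in>I. f i x) \<oplus>\<^bsub>N\<^esub> (\<Oplus>\<^bsub>N\<^esub>i\<in>I. f i y)" .
  next
    fix a x
    assume ax: "a \<in> carrier A" "x \<in> carrier M"
    have "(\<Oplus>\<^bsub>N\<^esub>i\<in>I. f i (a \<odot>\<^bsub>M\<^esub> x)) = (\<Oplus>\<^bsub>N\<^esub>i\<in>I. a \<odot>\<^bsub>N\<^esub> f i x)"
      using linear_mapsD[OF assms(4)] ax by (intro N.finsum_cong') auto
    also have "\<dots> = a \<odot>\<^bsub>N\<^esub> (\<Oplus>\<^bsub>N\<^esub>i\<in>I. f i x)"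
      using linear_mapsD[OF assms(4)] ax by (intro N.finsum_smult_ldistr[symmetric] assms(3)) auto
    finally show "(\<Oplus>\<^bsub>N\<^esub>i\<in>I. f i (a \<odot>\<^bsub>M\<^esub> x)) = a \<odot>\<^bsub>N\<^esub> (\<Oplus>\<^bsub>N\<^esub>i\<in>I. f i x)" .
  qed (use linear_mapsD[OF assms(4)] in \<open>auto intro!: N.finsum_closed\<close>)
qed

locale ring_decomposition = A: cring A for A :: "('a, 'm) ring_scheme" +
  fixes I :: "'i set" and B :: "'i \<Rightarrow> ('b, 'n) ring_scheme"
    and \<pi> :: "'i \<Rightarrow> 'a \<Rightarrow> 'b" and \<iota> :: "'i \<Rightarrow> 'b \<Rightarrow> 'a"
  assumes finite_index: "finite I"
    and factor: "i \<in> I \<Longrightarrow> ring_factor A (B i) (\<pi> i) (\<iota> i)"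
    and sum_units: "(\<Oplus>\<^bsub>A\<^esub>i\<in>I. \<iota> i \<one>\<^bsub>B i\<^esub>) = \<one>\<^bsub>A\<^esub>"
begin

lemma unit_closed: "i \<in> I \<Longrightarrow> \<iota> i \<one>\<^bsub>B i\<^esub> \<in> carrier A"
  using ring_factor.incl_closed[OF factor] cring.axioms(1) ring_factor.axioms(2)[OF factor]
  by (meson monoid.one_closed ring.is_monoid)

lemma decompose:
  assumes "module A P" "x \<in> carrier P"
  shows "(\<Oplus>\<^bsub>P\<^esub>i\<in>I. \<iota> i \<one>\<^bsub>B i\<^esub> \<odot>\<^bsub>P\<^esub> x) = x"
proof -
  interpret P: module A P by fact
  show ?thesis
    using P.finsum_smult_rdistr[of I "\<lambda>i. \<iota> i \<one>\<^bsub>B i\<^esub>" x] finite_index sum_units assms(2) unit_closed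
    by (simp add: Pi_def)
qed

text \<open>
  The component \<open>e\<^sub>i P \<rightarrow> e\<^sub>i Q\<close> of a surjection is surjective, since \<open>e\<^sub>i g x = g (e\<^sub>i x)\<close>. So the \<open>i\<close>-th
  component of the problem is solvable over \<open>B\<^sub>i\<close>, which gives an \<open>A\<close>-linear \<open>h\<^sub>i\<close> with
  \<open>g (h\<^sub>i x) = e\<^sub>i f x\<close>; the sum of the \<open>h\<^sub>i\<close> lifts \<open>f\<close>.
\<close>

lemma projective_module_if_factors:
  assumes N: "module A N"
    and factors: "\<And>i. i \<in> I \<Longrightarrow> module_factor A (B i) (\<pi> i) (\<iota> i) N (N' i) (p i) (j i)"
    and proj: "\<And>i. i \<in> I \<Longrightarrow> projective_module TYPE('u) (B i) (N' i)"
  shows "projective_module TYPE('u) A N"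
  unfolding projective_module_def
proof (intro conjI allI impI)
  interpret N: module A N by fact
  show "module A N" by fact
  fix P Q :: "('a, 'u) module" and g f
  assume "module A P \<and> module A Q \<and> g \<in> linear_maps A P Q \<and>
      g ` carrier P = carrier Q \<and> f \<in> linear_maps A N Q"
  then have P: "module A P" and Q: "module A Q" and g: "g \<in> linear_maps A P Q"
    and surj: "g ` carrier P = carrier Q" and f: "f \<in> linear_maps A N Q"
    by auto
  interpret P: module A P by fact
  interpret Q: module A Q by fact
  define e where "e i = \<iota> i \<one>\<^bsub>B i\<^esub>" for i
  have "\<exists>h\<in>linear_maps A N P. \<forall>x\<in>carrier N. g (h x) = e i \<odot>\<^bsub>Q\<^esub> f x" if i: "i \<in> I" for i
  proof -
    interpret F: module_factor A "B i" "\<pi> i" "\<iota> i" N "N' i" "p i" "j i"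
      by (rule factors[OF i])
    let ?P = "factor_module (B i) (\<iota> i) P" and ?Q = "factor_module (B i) (\<iota> i) Q"
    have e: "e i \<in> carrier A" "e i \<otimes>\<^bsub>A\<^esub> e i = e i"
      using unit_closed[OF i] F.incl_eq[of "\<one>\<^bsub>B i\<^esub>"] by (simp_all add: e_def)
    note FP = F.module_factor_factor_module[OF P] and FQ = F.module_factor_factor_module[OF Q]
    have g_fix: "e i \<odot>\<^bsub>Q\<^esub> g x = g x" if "x \<in> carrier ?P" for x
      using module_factor.unit_smult_j[OF FP that] linear_mapsD(3)[OF g, of "e i" x] e
        module_factor.j_closed[OF FP that]
      by (simp add: e_def)
    have gi: "(\<lambda>x. e i \<odot>\<^bsub>Q\<^esub> g x) \<in> linear_maps (B i) ?P ?Q"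
      using linear_map_to_factor[OF FP FQ g] by (simp add: e_def)
    have surj_i: "(\<lambda>x. e i \<odot>\<^bsub>Q\<^esub> g x) ` carrier ?P = carrier ?Q"
    proof (rule equalityI)
      show "(\<lambda>x. e i \<odot>\<^bsub>Q\<^esub> g x) ` carrier ?P \<subseteq> carrier ?Q"
        using linear_mapsD(1)[OF gi] by blast
      show "carrier ?Q \<subseteq> (\<lambda>x. e i \<odot>\<^bsub>Q\<^esub> g x) ` carrier ?P"
      proof
        fix y
        assume "y \<in> carrier ?Q"
        then obtain z where z: "z \<in> carrier Q" "y = e i \<odot>\<^bsub>Q\<^esub> z"
          by (auto simp: e_def)
        then obtain x where x: "x \<in> carrier P" "z = g x"
          using surj by auto
        have "y = e i \<odot>\<^bsub>Q\<^esub> g (e i \<odot>\<^bsub>P\<^esub> x)"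
          using e x z by (simp add: linear_mapsD[OF g] flip: Q.smult_assoc1)
        then show "y \<in> (\<lambda>x. e i \<odot>\<^bsub>Q\<^esub> g x) ` carrier ?P"
          using x by (auto simp: e_def)
      qed
    qed
    have fi: "(\<lambda>x. e i \<odot>\<^bsub>Q\<^esub> f (j i x)) \<in> linear_maps (B i) (N' i) ?Q"
      using linear_map_to_factor[OF factors[OF i] FQ f] by (simp add: e_def)
    obtain h where h: "h \<in> linear_maps (B i) (N' i) ?P"
      and lift: "\<And>y. y \<in> carrier (N' i) \<Longrightarrow> e i \<odot>\<^bsub>Q\<^esub> g (h y) = e i \<odot>\<^bsub>Q\<^esub> f (j i y)"
      using proj[OF i] module_factor.axioms(3)[OF FP] module_factor.axioms(3)[OF FQ] gi surj_i fi
      unfolding projective_module_def by blast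
    have "(\<lambda>x. h (p i x)) \<in> linear_maps A N P"
      using linear_map_from_factor[OF factors[OF i] FP h] .
    moreover have "g (h (p i x)) = e i \<odot>\<^bsub>Q\<^esub> f x" if x: "x \<in> carrier N" for x
    proof -
      have "h (p i x) \<in> carrier ?P"
        using linear_mapsD(1)[OF h] x F.p_closed by blast
      then have "g (h (p i x)) = e i \<odot>\<^bsub>Q\<^esub> f (e i \<odot>\<^bsub>N\<^esub> x)"
        using g_fix lift[of "p i x"] x by (simp add: F.j_p e_def)
      then show ?thesis
        using e x by (simp add: linear_mapsD[OF f] flip: Q.smult_assoc1)
    qed
    ultimately show ?thesis
      by (intro bexI[of _ "\<lambda>x. h (p i x)"] ballI)
  qed
  then obtain h where h: "\<And>i. i \<in> I \<Longrightarrow> h i \<in> linear_maps A N P"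
    and lift: "\<And>i x. \<lbrakk>i \<in> I; x \<in> carrier N\<rbrakk> \<Longrightarrow> g (h i x) = e i \<odot>\<^bsub>Q\<^esub> f x"
    by metis
  have "g (\<Oplus>\<^bsub>P\<^esub>i\<in>I. h i x) = f x" if x: "x \<in> carrier N" for x
  proof -
    have "g (\<Oplus>\<^bsub>P\<^esub>i\<in>I. h i x) = (\<Oplus>\<^bsub>Q\<^esub>i\<in>I. g (h i x))"
      using linear_mapsD(1)[OF h] x by (intro linear_map_finsum[OF P Q g finite_index]) auto
    also have "\<dots> = (\<Oplus>\<^bsub>Q\<^esub>i\<in>I. e i \<odot>\<^bsub>Q\<^esub> f x)"
      using x unit_closed linear_mapsD(1)[OF f] by (intro Q.finsum_cong') (auto simp: lift e_def)
    also have "\<dots> = f x"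
      using decompose[OF Q, of "f x"] linear_mapsD(1)[OF f x] by (simp add: e_def)
    finally show ?thesis .
  qed
  moreover have "(\<lambda>x. \<Oplus>\<^bsub>P\<^esub>i\<in>I. h i x) \<in> linear_maps A N P"
    by (rule linear_map_sum_of_maps[OF N P finite_index h])
  ultimately show "\<exists>h\<in>linear_maps A N P. \<forall>x\<in>carrier N. g (h x) = f x"
    by (intro bexI[of _ "\<lambda>x. \<Oplus>\<^bsub>P\<^esub>i\<in>I. h i x"] ballI)
qed

end

section \<open>Flatness and direct factors\<close>

definition frag_map :: "('a \<Rightarrow> 'b) \<Rightarrow> ('a \<Rightarrow>\<^sub>0 int) \<Rightarrow> ('b \<Rightarrow>\<^sub>0 int)" where
  "frag_map h = frag_extend (\<lambda>x. frag_of (h x))"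

lemma frag_map_simps [simp]:
  "frag_map h 0 = 0" "frag_map h (frag_of x) = frag_of (h x)" "frag_map h (- z) = - frag_map h z"
  "frag_map h (z + w) = frag_map h z + frag_map h w"
  "frag_map h (z - w) = frag_map h z - frag_map h w"
  by (simp_all add: frag_map_def frag_extend_minus frag_extend_add frag_extend_diff)

lemma keys_frag_map: "Poly_Mapping.keys (frag_map h z) \<subseteq> h ` Poly_Mapping.keys z"
  using keys_frag_extend[of "\<lambda>x. frag_of (h x)" z] by (auto simp: frag_map_def)

lemma frag_map_frag_map: "frag_map g (frag_map h z) = frag_map (\<lambda>x. g (h x)) z"
  using frag_extend_compose[of "\<lambda>x. frag_of (g x)" h z] by (simp add: frag_map_def o_def)

lemma frag_map_cong:
  "(\<And>x. x \<in> Poly_Mapping.keys z \<Longrightarrow> g x = h x) \<Longrightarrow> frag_map g z = frag_map h z"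
  unfolding frag_map_def by (rule frag_extend_eq) simp

lemma frag_map_id:
  assumes "\<And>x. x \<in> Poly_Mapping.keys z \<Longrightarrow> h x = x"
  shows "frag_map h z = z"
proof -
  have "frag_map h z = frag_map (\<lambda>x. x) z"
    using assms by (rule frag_map_cong)
  then show ?thesis
    using frag_expansion[of z] by (simp add: frag_map_def)
qed

lemma keys_diff_subset:
  "\<lbrakk>Poly_Mapping.keys z \<subseteq> S; Poly_Mapping.keys w \<subseteq> S\<rbrakk> \<Longrightarrow> Poly_Mapping.keys (z - w) \<subseteq> S"
  for z w :: "'a \<Rightarrow>\<^sub>0 int"
  using keys_diff[of z w] by blast

lemma tensor_relations_subset:
  assumes "module A P" "module A N"
  shows "tensor_relations A P N \<subseteq> carrier (free_Abelian_group (carrier P \<times> carrier N))"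
proof -
  interpret P: module A P by fact
  interpret N: module A N by fact
  show ?thesis
    unfolding tensor_relations_def
    by (rule subsetI, elim UnE CollectE exE conjE; hypsubst;
        unfold carrier_free_Abelian_group_iff; intro keys_diff_subset; simp add: keys_frag_of)
qed

lemma tensor_kernel_subgroup:
  assumes "module A P" "module A N"
  shows "subgroup (tensor_kernel A P N) (free_Abelian_group (carrier P \<times> carrier N))"
  unfolding tensor_kernel_def
  by (intro group.generate_is_subgroup tensor_relations_subset assms) simp

lemma tensor_kernel_closed:
  assumes "module A P" "module A N"
  shows "0 \<in> tensor_kernel A P N"
    and "z \<in> tensor_kernel A P N \<Longrightarrow> Poly_Mapping.keys z \<subseteq> carrier P \<times> carrier N"
    and "\<lbrakk>z \<in> tensor_kernel A P N; w \<in> tensor_kernel A P N\<rbrakk> \<Longrightarrow> z + w \<in> tensor_kernel A P N"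
    and "z \<in> tensor_kernel A P N \<Longrightarrow> - z \<in> tensor_kernel A P N"
    and "\<lbrakk>z \<in> tensor_kernel A P N; w \<in> tensor_kernel A P N\<rbrakk> \<Longrightarrow> z - w \<in> tensor_kernel A P N"
proof -
  note K = tensor_kernel_subgroup[OF assms]
  show "0 \<in> tensor_kernel A P N"
    using subgroup.one_closed[OF K] by simp
  show keys: "Poly_Mapping.keys z \<subseteq> carrier P \<times> carrier N" if "z \<in> tensor_kernel A P N" for z
    using subgroup.mem_carrier[OF K that] by simp
  show add: "z + w \<in> tensor_kernel A P N" if "z \<in> tensor_kernel A P N" "w \<in> tensor_kernel A P N" for z w
    using subgroup.m_closed[OF K that] by simp
  show uminus: "- z \<in> tensor_kernel A P N" if "z \<in> tensor_kernel A P N" for z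
    using subgroup.m_inv_closed[OF K that] keys[OF that] by simp
  show "z - w \<in> tensor_kernel A P N" if "z \<in> tensor_kernel A P N" "w \<in> tensor_kernel A P N" for z w
    using add[OF that(1) uminus[OF that(2)]] by simp
qed

lemma tensor_kernel_relations:
  shows tensor_kernel_add_left: "\<lbrakk>x \<in> carrier P; x' \<in> carrier P; y \<in> carrier N\<rbrakk> \<Longrightarrow>
      frag_of (x \<oplus>\<^bsub>P\<^esub> x', y) - frag_of (x, y) - frag_of (x', y) \<in> tensor_kernel A P N"
    and tensor_kernel_add_right: "\<lbrakk>x \<in> carrier P; y \<in> carrier N; y' \<in> carrier N\<rbrakk> \<Longrightarrow>
      frag_of (x, y \<oplus>\<^bsub>N\<^esub> y') - frag_of (x, y) - frag_of (x, y') \<in> tensor_kernel A P N"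
    and tensor_kernel_smult: "\<lbrakk>a \<in> carrier A; x \<in> carrier P; y \<in> carrier N\<rbrakk> \<Longrightarrow>
      frag_of (a \<odot>\<^bsub>P\<^esub> x, y) - frag_of (x, a \<odot>\<^bsub>N\<^esub> y) \<in> tensor_kernel A P N"
  unfolding tensor_kernel_def by (intro generate.incl; force simp: tensor_relations_def)+

text \<open>
  A pair of maps that are semilinear over the same \<open>\<phi>\<close> sends each defining relation of the tensor
  product to another one. It covers \<open>f \<otimes> id\<close> as well as the passage to a factor and back; in the
  last case \<open>\<phi> = \<iota>\<close> need not preserve \<open>1\<close>.
\<close>

lemma frag_map_tensor_kernel:
  assumes modules: "module A P" "module A N" "module A' P'" "module A' N'"
    and \<phi>: "\<And>a. a \<in> carrier A \<Longrightarrow> \<phi> a \<in> carrier A'"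
    and u: "\<And>x. x \<in> carrier P \<Longrightarrow> u x \<in> carrier P'"
      "\<And>x y. \<lbrakk>x \<in> carrier P; y \<in> carrier P\<rbrakk> \<Longrightarrow> u (x \<oplus>\<^bsub>P\<^esub> y) = u x \<oplus>\<^bsub>P'\<^esub> u y"
      "\<And>a x. \<lbrakk>a \<in> carrier A; x \<in> carrier P\<rbrakk> \<Longrightarrow> u (a \<odot>\<^bsub>P\<^esub> x) = \<phi> a \<odot>\<^bsub>P'\<^esub> u x"
    and v: "\<And>x. x \<in> carrier N \<Longrightarrow> v x \<in> carrier N'"
      "\<And>x y. \<lbrakk>x \<in> carrier N; y \<in> carrier N\<rbrakk> \<Longrightarrow> v (x \<oplus>\<^bsub>N\<^esub> y) = v x \<oplus>\<^bsub>N'\<^esub> v y"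
      "\<And>a x. \<lbrakk>a \<in> carrier A; x \<in> carrier N\<rbrakk> \<Longrightarrow> v (a \<odot>\<^bsub>N\<^esub> x) = \<phi> a \<odot>\<^bsub>N'\<^esub> v x"
    and z: "z \<in> tensor_kernel A P N"
  shows "frag_map (map_prod u v) z \<in> tensor_kernel A' P' N'"
proof -
  note K' = tensor_kernel_closed[OF modules(3,4)]
  have rel: "frag_map (map_prod u v) h \<in> tensor_kernel A' P' N'"
    if "h \<in> tensor_relations A P N" for h
    using that \<phi> u v
    by (auto simp: tensor_relations_def tensor_kernel_relations)
  show ?thesis
    using z unfolding tensor_kernel_def
  proof (induction rule: generate.induct)
    case one
    then show ?case using K'(1) by (simp add: tensor_kernel_def)
  next
    case (incl h)
    then show ?case using rel by (simp add: tensor_kernel_def)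
  next
    case (inv h)
    then have "Poly_Mapping.keys h \<subseteq> carrier P \<times> carrier N"
      using subsetD[OF tensor_relations_subset[OF modules(1,2)]] by simp
    then show ?case
      using K'(4)[OF rel[OF inv]] by (simp add: tensor_kernel_def)
  next
    case (eng h h')
    then show ?case using K'(3) by (simp add: tensor_kernel_def)
  qed
qed

lemma tensor_kernel_coset_eq_iff:
  assumes "module A P" "module A N"
  shows "tensor_kernel A P N #>\<^bsub>free_Abelian_group (carrier P \<times> carrier N)\<^esub> z =
      tensor_kernel A P N #>\<^bsub>free_Abelian_group (carrier P \<times> carrier N)\<^esub> w \<longleftrightarrow>
    z - w \<in> tensor_kernel A P N"
    (is "?C z = ?C w \<longleftrightarrow> _")
proof -
  note K = tensor_kernel_closed[OF assms]
  have mem: "y \<in> ?C x \<longleftrightarrow> y - x \<in> tensor_kernel A P N" for x y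
    by (auto simp: r_coset_def intro: bexI[of _ "y - x"])
  show ?thesis
  proof
    assume "?C z = ?C w"
    then show "z - w \<in> tensor_kernel A P N"
      using mem[of z z] mem[of z w] K(1) by simp
  next
    assume zw: "z - w \<in> tensor_kernel A P N"
    have "y - z \<in> tensor_kernel A P N \<longleftrightarrow> y - w \<in> tensor_kernel A P N" for y
      using K(3)[OF _ zw, of "y - z"] K(5)[OF _ zw, of "y - w"] by auto
    then show "?C z = ?C w"
      by (simp add: set_eq_iff mem)
  qed
qed

text \<open>
  Injectivity of \<open>f \<otimes> id\<close> in terms of representatives: cosets and chosen elements do not occur
  beyond this point.
\<close>

lemma inj_on_tensor_map_iff:
  fixes N :: "('a, 'd, 'k) module_scheme"
  assumes modules: "module A P" "module A Q" "module A N" and f: "f \<in> linear_maps A P Q"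
  shows "inj_on (tensor_map A Q N f) (carrier (tensor_product A P N)) \<longleftrightarrow>
    (\<forall>z. Poly_Mapping.keys z \<subseteq> carrier P \<times> carrier N \<longrightarrow>
       frag_map (map_prod f (\<lambda>y. y)) z \<in> tensor_kernel A Q N \<longrightarrow> z \<in> tensor_kernel A P N)"
proof -
  let ?S = "carrier P \<times> carrier N" and ?S' = "carrier Q \<times> carrier N"
  let ?C = "\<lambda>z. tensor_kernel A P N #>\<^bsub>free_Abelian_group ?S\<^esub> z"
  let ?C' = "\<lambda>z. tensor_kernel A Q N #>\<^bsub>free_Abelian_group ?S'\<^esub> z"
  define F where "F = frag_map (map_prod f (\<lambda>y :: 'd. y))"
  note K = tensor_kernel_closed[OF modules(1,3)] and K' = tensor_kernel_closed[OF modules(2,3)]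
  note C = tensor_kernel_coset_eq_iff[OF modules(1,3)]
    and C' = tensor_kernel_coset_eq_iff[OF modules(2,3)]
  have F_kernel: "F z \<in> tensor_kernel A Q N" if "z \<in> tensor_kernel A P N" for z
    unfolding F_def using linear_mapsD[OF f] that
    by (intro frag_map_tensor_kernel[OF modules(1,3,2,3), where \<phi> = "\<lambda>a. a"]) auto
  have F_add: "F (z + w) = F z + F w" and F_diff: "F (z - w) = F z - F w" "F 0 = 0" for z w
    by (simp_all add: F_def)
  have map: "tensor_map A Q N f (?C z) = ?C' (F z)" for z
  proof -
    have "(\<lambda>(x, y). frag_of (f x, y)) = (\<lambda>xy. frag_of (map_prod f (\<lambda>y :: 'd. y) xy))"
      by (simp add: fun_eq_iff)
    then have "tensor_map A Q N f (?C z) = the_elem ((\<lambda>w. ?C' (F w)) ` ?C z)"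
      by (simp add: tensor_map_def F_def frag_map_def)
    also have "\<dots> = ?C' (F z)"
    proof (rule the_elem_image_unique)
      show "?C z \<noteq> {}"
        using K(1) by (auto simp: r_coset_def)
      fix w
      assume "w \<in> ?C z"
      then obtain k where "k \<in> tensor_kernel A P N" "w = k + z"
        by (auto simp: r_coset_def)
      then show "?C' (F w) = ?C' (F z)"
        by (simp add: C' F_add F_kernel)
    qed
    finally show ?thesis .
  qed
  have carrier: "carrier (tensor_product A P N) = ?C ` {z. Poly_Mapping.keys z \<subseteq> ?S}"
    by (auto simp: tensor_product_def FactGroup_def RCOSETS_def)
  have "inj_on (tensor_map A Q N f) (carrier (tensor_product A P N)) \<longleftrightarrow>
      (\<forall>z w. Poly_Mapping.keys z \<subseteq> ?S \<longrightarrow> Poly_Mapping.keys w \<subseteq> ?S \<longrightarrow>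
        F (z - w) \<in> tensor_kernel A Q N \<longrightarrow> z - w \<in> tensor_kernel A P N)"
    unfolding carrier inj_on_def ball_simps mem_Collect_eq map C C' F_diff by blast
  also have "\<dots> \<longleftrightarrow> (\<forall>z. Poly_Mapping.keys z \<subseteq> ?S \<longrightarrow>
       F z \<in> tensor_kernel A Q N \<longrightarrow> z \<in> tensor_kernel A P N)"
  proof (intro iffI allI impI)
    fix z
    assume "\<forall>z w. Poly_Mapping.keys z \<subseteq> ?S \<longrightarrow> Poly_Mapping.keys w \<subseteq> ?S \<longrightarrow>
        F (z - w) \<in> tensor_kernel A Q N \<longrightarrow> z - w \<in> tensor_kernel A P N"
    from this[rule_format, of z 0] show "Poly_Mapping.keys z \<subseteq> ?S \<Longrightarrow>
       F z \<in> tensor_kernel A Q N \<Longrightarrow> z \<in> tensor_kernel A P N"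
      by simp
  next
    fix z w
    assume *: "\<forall>z. Poly_Mapping.keys z \<subseteq> ?S \<longrightarrow>
       F z \<in> tensor_kernel A Q N \<longrightarrow> z \<in> tensor_kernel A P N"
      "Poly_Mapping.keys z \<subseteq> ?S" "Poly_Mapping.keys w \<subseteq> ?S"
      "F (z - w) \<in> tensor_kernel A Q N"
    have "Poly_Mapping.keys (z - w) \<subseteq> ?S"
      using *(2,3) by (rule keys_diff_subset)
    with * show "z - w \<in> tensor_kernel A P N" by blast
  qed
  finally show ?thesis by (simp add: F_def)
qed

lemma flat_moduleD:
  fixes P Q :: "('a, 'u) module"
  assumes "flat_module TYPE('u) A N" "module A P" "module A Q"
    and "f \<in> linear_maps A P Q" "inj_on f (carrier P)"
    and "Poly_Mapping.keys z \<subseteq> carrier P \<times> carrier N"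
    and "frag_map (map_prod f (\<lambda>y. y)) z \<in> tensor_kernel A Q N"
  shows "z \<in> tensor_kernel A P N"
  using assms inj_on_tensor_map_iff[of A P Q N f] by (auto simp: flat_module_def)

lemma flat_moduleI:
  fixes A :: "('a, 'm) ring_scheme" and N :: "('a, 'b, 'k) module_scheme"
  assumes "module A N"
    and "\<And>(P :: ('a, 'u) module) (Q :: ('a, 'u) module) f z.
      \<lbrakk>module A P; module A Q; f \<in> linear_maps A P Q; inj_on f (carrier P);
        Poly_Mapping.keys z \<subseteq> carrier P \<times> carrier N;
        frag_map (map_prod f (\<lambda>y. y)) z \<in> tensor_kernel A Q N\<rbrakk> \<Longrightarrow> z \<in> tensor_kernel A P N"
  shows "flat_module TYPE('u) A N"
  unfolding flat_module_def
proof (intro conjI allI impI assms(1))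
  fix P Q :: "('a, 'u) module" and f
  assume "module A P \<and> module A Q \<and> f \<in> linear_maps A P Q \<and> inj_on f (carrier P)"
  then show "inj_on (tensor_map A Q N f) (carrier (tensor_product A P N))"
    using assms(2)[of P Q f] inj_on_tensor_map_iff[of A P Q N f] assms(1) by simp
qed

lemma tensor_kernel_to_factor:
  assumes "module_factor A B \<pi> \<iota> P P' q k" "module_factor A B \<pi> \<iota> N N' p j"
    and "z \<in> tensor_kernel A P N"
  shows "frag_map (map_prod q p) z \<in> tensor_kernel B P' N'"
proof -
  interpret P: module_factor A B \<pi> \<iota> P P' q k by fact
  interpret N: module_factor A B \<pi> \<iota> N N' p j by fact
  show ?thesis
    using assms(3)
    by (rule frag_map_tensor_kernel[OF P.N.module_axioms N.N.module_axioms
          P.N'.module_axioms N.N'.module_axioms, where \<phi> = \<pi>, rotated -1])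
      (simp_all add: P.p_add P.p_smult N.p_add N.p_smult)
qed

lemma tensor_kernel_from_factor:
  assumes "module_factor A B \<pi> \<iota> P P' q k" "module_factor A B \<pi> \<iota> N N' p j"
    and "z \<in> tensor_kernel B P' N'"
  shows "frag_map (map_prod k j) z \<in> tensor_kernel A P N"
proof -
  interpret P: module_factor A B \<pi> \<iota> P P' q k by fact
  interpret N: module_factor A B \<pi> \<iota> N N' p j by fact
  show ?thesis
    using assms(3)
    by (rule frag_map_tensor_kernel[OF P.N'.module_axioms N.N'.module_axioms
          P.N.module_axioms N.N.module_axioms, where \<phi> = \<iota>, rotated -1])
      (simp_all add: P.j_add P.j_smult N.j_add N.j_smult)
qed

text \<open>
  Let \<open>z\<close> represent an element of \<open>P \<otimes> N'\<close> over \<open>B\<close> that \<open>f\<close> kills. Its image under \<open>j\<close> in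
  \<open>P \<otimes> N\<close> over \<open>A\<close> is killed by \<open>f\<close> too, hence vanishes by flatness of \<open>N\<close>, and \<open>p\<close> recovers
  \<open>z\<close> from it.
\<close>

lemma flat_module_factor:
  fixes A :: "('a, 'm) ring_scheme" and B :: "('b, 'n) ring_scheme"
  assumes factor: "module_factor A B \<pi> \<iota> N N' p j"
    and flat: "flat_module TYPE('u) A N"
  shows "flat_module TYPE('u) B N'"
proof -
  interpret module_factor A B \<pi> \<iota> N N' p j by fact
  show ?thesis
  proof (rule flat_moduleI)
    show "module B N'" by (rule N'.module_axioms)
    fix P Q :: "('b, 'u) module" and f z
    assume P: "module B P" and Q: "module B Q" and f: "f \<in> linear_maps B P Q"
      and inj: "inj_on f (carrier P)"
      and z: "Poly_Mapping.keys z \<subseteq> carrier P \<times> carrier N'"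
      and fz: "frag_map (map_prod f (\<lambda>y. y)) z \<in> tensor_kernel B Q N'"
    let ?P = "restrict_scalars \<pi> P" and ?Q = "restrict_scalars \<pi> Q"
    note FP = module_factor_restrict_scalars[OF P] and FQ = module_factor_restrict_scalars[OF Q]
    define w where "w = frag_map (map_prod (\<lambda>x :: 'u. x) j) z"
    have "frag_map (map_prod f (\<lambda>y. y)) w \<in> tensor_kernel A ?Q N"
      using tensor_kernel_from_factor[OF FQ factor fz]
      by (simp add: w_def frag_map_frag_map prod.map_comp o_def)
    moreover have "f \<in> linear_maps A ?P ?Q"
      using linear_map_from_factor[OF FP FQ f] .
    moreover have "Poly_Mapping.keys w \<subseteq> carrier ?P \<times> carrier N"
      using z keys_frag_map[of "map_prod (\<lambda>x. x) j" z] by (force simp: w_def)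
    ultimately have "w \<in> tensor_kernel A ?P N"
      using module_restrict_scalars[OF A.is_cring proj_hom] P Q inj
      by (intro flat_moduleD[OF flat, of ?P ?Q f]) simp_all
    then have "frag_map (map_prod (\<lambda>x. x) p) w \<in> tensor_kernel B P N'"
      by (rule tensor_kernel_to_factor[OF FP factor])
    moreover have "frag_map (map_prod (\<lambda>x. x) p) w = z"
      unfolding w_def frag_map_frag_map using z by (intro frag_map_id) auto
    ultimately show "z \<in> tensor_kernel B P N'" by simp
  qed
qed

lemma tensor_kernel_finsum_left:
  assumes "module A P" "module A N" "finite I" "x \<in> I \<rightarrow> carrier P" "y \<in> carrier N"
  shows "frag_of (\<Oplus>\<^bsub>P\<^esub>i\<in>I. x i, y) - (\<Sum>i\<in>I. frag_of (x i, y)) \<in> tensor_kernel A P N"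
proof -
  interpret P: module A P by fact
  note K = tensor_kernel_closed[OF assms(1,2)]
  show ?thesis
    using assms(3,4)
  proof (induction I)
    case empty
    have "- (frag_of (\<zero>\<^bsub>P\<^esub> \<oplus>\<^bsub>P\<^esub> \<zero>\<^bsub>P\<^esub>, y) - frag_of (\<zero>\<^bsub>P\<^esub>, y) - frag_of (\<zero>\<^bsub>P\<^esub>, y)) \<in> tensor_kernel A P N"
      using assms(5) by (intro K(4) tensor_kernel_add_left) simp_all
    then show ?case by simp
  next
    case (insert i I)
    let ?s = "\<Oplus>\<^bsub>P\<^esub>i\<in>I. x i"
    have "frag_of (x i \<oplus>\<^bsub>P\<^esub> ?s, y) - frag_of (x i, y) - frag_of (?s, y) \<in> tensor_kernel A P N"
      using insert.prems assms(5) by (intro tensor_kernel_add_left P.finsum_closed) auto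
    moreover have "frag_of (?s, y) - (\<Sum>i\<in>I. frag_of (x i, y)) \<in> tensor_kernel A P N"
      using insert by auto
    ultimately have "(frag_of (x i \<oplus>\<^bsub>P\<^esub> ?s, y) - frag_of (x i, y) - frag_of (?s, y)) +
        (frag_of (?s, y) - (\<Sum>i\<in>I. frag_of (x i, y))) \<in> tensor_kernel A P N"
      by (rule K(3))
    moreover have "(\<Oplus>\<^bsub>P\<^esub>i\<in>insert i I. x i) = x i \<oplus>\<^bsub>P\<^esub> ?s"
      using insert by (intro P.finsum_insert) auto
    ultimately show ?case
      using insert(1,2) by (simp add: algebra_simps)
  qed
qed

context ring_decomposition
begin

text \<open>
  \<open>x \<otimes> y = \<Sum> e\<^sub>i x \<otimes> y\<close>, and \<open>e\<^sub>i x \<otimes> y = e\<^sub>i (e\<^sub>i x) \<otimes> y = e\<^sub>i x \<otimes> e\<^sub>i y\<close>.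
\<close>

lemma tensor_decompose:
  assumes P: "module A P" and N: "module A N"
    and z: "Poly_Mapping.keys z \<subseteq> carrier P \<times> carrier N"
  shows "z - (\<Sum>i\<in>I. frag_map (map_prod (\<lambda>x. \<iota> i \<one>\<^bsub>B i\<^esub> \<odot>\<^bsub>P\<^esub> x) (\<lambda>y. \<iota> i \<one>\<^bsub>B i\<^esub> \<odot>\<^bsub>N\<^esub> y)) z)
    \<in> tensor_kernel A P N"
proof -
  interpret P: module A P by fact
  interpret N: module A N by fact
  note K = tensor_kernel_closed[OF P N]
  let ?E = "\<lambda>i. frag_map (map_prod (\<lambda>x. \<iota> i \<one>\<^bsub>B i\<^esub> \<odot>\<^bsub>P\<^esub> x) (\<lambda>y. \<iota> i \<one>\<^bsub>B i\<^esub> \<odot>\<^bsub>N\<^esub> y))"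
  show ?thesis
    using z
  proof (induction z rule: free_Abelian_group_induct[consumes 1, case_names zero diff of])
    case zero
    show ?case using K(1) by simp
  next
    case (diff z w)
    have "(z - w) - (\<Sum>i\<in>I. ?E i (z - w)) = (z - (\<Sum>i\<in>I. ?E i z)) - (w - (\<Sum>i\<in>I. ?E i w))"
      by (simp add: sum_subtractf)
    then show ?case
      using K(5)[OF diff(3,4)] by (simp only:)
  next
    case (of xy)
    then obtain x y where xy: "xy = (x, y)" "x \<in> carrier P" "y \<in> carrier N"
      by auto
    define e where "e i = \<iota> i \<one>\<^bsub>B i\<^esub>" for i
    have e: "e i \<in> carrier A" "e i \<otimes>\<^bsub>A\<^esub> e i = e i" if "i \<in> I" for i
    proof -
      interpret ring_factor A "B i" "\<pi> i" "\<iota> i" by (rule factor[OF that])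
      show "e i \<in> carrier A" "e i \<otimes>\<^bsub>A\<^esub> e i = e i"
        using incl_eq[of "\<one>\<^bsub>B i\<^esub>"] by (simp_all add: e_def)
    qed
    have "frag_of (e i \<odot>\<^bsub>P\<^esub> x, y) - frag_of (e i \<odot>\<^bsub>P\<^esub> x, e i \<odot>\<^bsub>N\<^esub> y) \<in> tensor_kernel A P N"
      if "i \<in> I" for i
      using tensor_kernel_smult[of "e i" A "e i \<odot>\<^bsub>P\<^esub> x" P y N] e[OF that] xy
      by (simp flip: P.smult_assoc1)
    then have "(\<Sum>i\<in>J. frag_of (e i \<odot>\<^bsub>P\<^esub> x, y) - frag_of (e i \<odot>\<^bsub>P\<^esub> x, e i \<odot>\<^bsub>N\<^esub> y)) \<in> tensor_kernel A P N"
      if "J \<subseteq> I" for J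
      using that by (induction J rule: infinite_finite_induct) (auto intro: K(1,3))
    from this[of I]
    have *: "(\<Sum>i\<in>I. frag_of (e i \<odot>\<^bsub>P\<^esub> x, y) - frag_of (e i \<odot>\<^bsub>P\<^esub> x, e i \<odot>\<^bsub>N\<^esub> y)) \<in> tensor_kernel A P N"
      by simp
    have "frag_of (\<Oplus>\<^bsub>P\<^esub>i\<in>I. e i \<odot>\<^bsub>P\<^esub> x, y) - (\<Sum>i\<in>I. frag_of (e i \<odot>\<^bsub>P\<^esub> x, y)) \<in> tensor_kernel A P N"
      using xy e by (intro tensor_kernel_finsum_left P N finite_index) auto
    then have "frag_of (x, y) - (\<Sum>i\<in>I. frag_of (e i \<odot>\<^bsub>P\<^esub> x, y)) \<in> tensor_kernel A P N"
      using decompose[OF P xy(2)] by (simp add: e_def)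
    from K(3)[OF this *] show ?case
      by (simp add: xy(1) sum_subtractf e_def)
  qed
qed

text \<open>
  If \<open>f\<close> kills \<open>z\<close>, then the restriction \<open>f'\<close> of \<open>f\<close> to \<open>e\<^sub>i P\<close>, which is still injective, kills the
  \<open>i\<close>-th component of \<open>z\<close>. By flatness over \<open>B\<^sub>i\<close> each component vanishes, and so does their sum \<open>z\<close>.
\<close>

lemma flat_module_if_factors:
  assumes N: "module A N"
    and factors: "\<And>i. i \<in> I \<Longrightarrow> module_factor A (B i) (\<pi> i) (\<iota> i) N (N' i) (p i) (j i)"
    and flat: "\<And>i. i \<in> I \<Longrightarrow> flat_module TYPE('u) (B i) (N' i)"
  shows "flat_module TYPE('u) A N"
proof (rule flat_moduleI)
  show "module A N" by fact
  fix P Q :: "('a, 'u) module" and f z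
  assume P: "module A P" and Q: "module A Q" and f: "f \<in> linear_maps A P Q"
    and inj: "inj_on f (carrier P)"
    and z: "Poly_Mapping.keys z \<subseteq> carrier P \<times> carrier N"
    and fz: "frag_map (map_prod f (\<lambda>y. y)) z \<in> tensor_kernel A Q N"
  note K = tensor_kernel_closed[OF P N]
  let ?E = "\<lambda>i. frag_map (map_prod (\<lambda>x. \<iota> i \<one>\<^bsub>B i\<^esub> \<odot>\<^bsub>P\<^esub> x) (\<lambda>y. \<iota> i \<one>\<^bsub>B i\<^esub> \<odot>\<^bsub>N\<^esub> y))"
  have "?E i z \<in> tensor_kernel A P N" if i: "i \<in> I" for i
  proof -
    interpret F: module_factor A "B i" "\<pi> i" "\<iota> i" N "N' i" "p i" "j i"
      by (rule factors[OF i])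
    define e where "e = \<iota> i \<one>\<^bsub>B i\<^esub>"
    let ?P = "factor_module (B i) (\<iota> i) P" and ?Q = "factor_module (B i) (\<iota> i) Q"
    have FP: "module_factor A (B i) (\<pi> i) (\<iota> i) P ?P (\<lambda>x. e \<odot>\<^bsub>P\<^esub> x) (\<lambda>x. x)"
      and FQ: "module_factor A (B i) (\<pi> i) (\<iota> i) Q ?Q (\<lambda>x. e \<odot>\<^bsub>Q\<^esub> x) (\<lambda>x. x)"
      using F.module_factor_factor_module[OF P] F.module_factor_factor_module[OF Q]
      by (simp_all add: e_def)
    have P_sub: "x \<in> carrier P" "e \<odot>\<^bsub>P\<^esub> x = x" if "x \<in> carrier ?P" for x
      using module_factor.j_closed[OF FP that] module_factor.p_j[OF FP that] by auto
    have e: "e \<in> carrier A"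
      using unit_closed[OF i] by (simp add: e_def)
    define f' where "f' x = e \<odot>\<^bsub>Q\<^esub> f x" for x
    have f': "f' \<in> linear_maps (B i) ?P ?Q"
      using linear_map_to_factor[OF FP FQ f] by (simp add: f'_def[abs_def])
    have f'_eq: "f' x = f x" if "x \<in> carrier ?P" for x
      using P_sub[OF that] linear_mapsD(3)[OF f e, of x] by (simp add: f'_def)
    have "inj_on f' (carrier ?P)"
      using inj P_sub(1) f'_eq by (simp only: inj_on_def) metis
    \<comment> \<open>\<open>w\<close> represents the \<open>i\<close>-th component of \<open>z\<close> in \<open>e\<^sub>i P \<otimes> N'\<^sub>i\<close>.\<close>
    define w where "w = frag_map (map_prod (\<lambda>x. e \<odot>\<^bsub>P\<^esub> x) (p i)) z"
    have w: "Poly_Mapping.keys w \<subseteq> carrier ?P \<times> carrier (N' i)"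
      using z keys_frag_map[of "map_prod (\<lambda>x. e \<odot>\<^bsub>P\<^esub> x) (p i)" z]
        module_factor.p_closed[OF FP] F.p_closed by (fastforce simp: w_def simp del: factor_module_simps)
    have "f' (e \<odot>\<^bsub>P\<^esub> x) = e \<odot>\<^bsub>Q\<^esub> f x" if "x \<in> carrier P" for x
      using f'_eq[OF module_factor.p_closed[OF FP that]] linear_mapsD(3)[OF f e that] by simp
    then have "frag_map (map_prod f' (\<lambda>y. y)) w =
        frag_map (map_prod (\<lambda>x. e \<odot>\<^bsub>Q\<^esub> x) (p i)) (frag_map (map_prod f (\<lambda>y. y)) z)"
      unfolding w_def frag_map_frag_map using z by (intro frag_map_cong) auto
    also have "\<dots> \<in> tensor_kernel (B i) ?Q (N' i)"
      using tensor_kernel_to_factor[OF FQ factors[OF i] fz] .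
    finally have "w \<in> tensor_kernel (B i) ?P (N' i)"
      by (intro flat_moduleD[OF flat[OF i] module_factor.axioms(3)[OF FP]
            module_factor.axioms(3)[OF FQ] f' \<open>inj_on f' _\<close> w])
    then have "frag_map (map_prod (\<lambda>x. x) (j i)) w \<in> tensor_kernel A P N"
      by (rule tensor_kernel_from_factor[OF FP factors[OF i]])
    also have "frag_map (map_prod (\<lambda>x. x) (j i)) w = ?E i z"
      unfolding w_def frag_map_frag_map using z by (intro frag_map_cong) (auto simp: F.j_p e_def)
    finally show ?thesis .
  qed
  then have "(\<Sum>i\<in>J. ?E i z) \<in> tensor_kernel A P N" if "J \<subseteq> I" for J
    using that by (induction J rule: infinite_finite_induct) (auto intro: K(1,3))
  from K(3)[OF tensor_decompose[OF P N z] this[of I]] show "z \<in> tensor_kernel A P N"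
    by simp
qed

end

section \<open>Localization of direct factors\<close>

lemma (in ring_factor) module_factor_self:
  "module_factor A B \<pi> \<iota> (ring_as_module A) (ring_as_module B) \<pi> \<iota>"
proof -
  interpret N: module A "ring_as_module A" by (rule module_ring_as_module[OF A.is_cring])
  interpret N': module B "ring_as_module B" by (rule module_ring_as_module[OF B.is_cring])
  show ?thesis
    using ring_hom_add[OF proj_hom] ring_hom_mult[OF proj_hom]
    by unfold_locales (simp_all add: incl_add incl_mult incl_proj)
qed

text \<open>
  The map \<open>x / s \<mapsto> u x / \<phi> s\<close>. Numerators and denominators are mapped separately: the inclusion of
  a factor acts on numerators as \<open>\<iota>\<close>, but \<open>\<iota> s\<close> is in general no denominator of \<open>A\<close>.
\<close>

definition fraction_map ::
    "'b set \<Rightarrow> ('b, 'd, 'l) module_scheme \<Rightarrow> ('c \<Rightarrow> 'd) \<Rightarrow> ('a \<Rightarrow> 'b) \<Rightarrow> ('c \<times> 'a) set \<Rightarrow> ('d \<times> 'b) set"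
  where "fraction_map T' N' u \<phi> X = (\<Union>(m, s)\<in>X. fraction T' N' (u m) (\<phi> s))"

lemma fraction_map_fraction:
  assumes "module_fractions A N T" "module_fractions B N' T'"
    and \<phi>: "\<And>s. s \<in> T \<Longrightarrow> \<phi> s \<in> T'" and u: "\<And>x. x \<in> carrier N \<Longrightarrow> u x \<in> carrier N'"
    and semilinear: "\<And>s x. \<lbrakk>s \<in> T; x \<in> carrier N\<rbrakk> \<Longrightarrow> u (s \<odot>\<^bsub>N\<^esub> x) = \<phi> s \<odot>\<^bsub>N'\<^esub> u x"
    and m: "m \<in> carrier N" "s \<in> T"
  shows "fraction_map T' N' u \<phi> (fraction T N m s) = fraction T' N' (u m) (\<phi> s)"
proof -
  interpret N: module_fractions A N T by fact
  interpret N': module_fractions B N' T' by fact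
  have "fraction T' N' (u n) (\<phi> t) = fraction T' N' (u m) (\<phi> s)"
    if n: "n \<in> carrier N" "t \<in> T" "fraction T N n t = fraction T N m s" for n t
  proof -
    from n m obtain v where v: "v \<in> T" "v \<odot>\<^bsub>N\<^esub> (s \<odot>\<^bsub>N\<^esub> n) = v \<odot>\<^bsub>N\<^esub> (t \<odot>\<^bsub>N\<^esub> m)"
      by (auto simp: N.fraction_eq_iff)
    then have "u (v \<odot>\<^bsub>N\<^esub> (s \<odot>\<^bsub>N\<^esub> n)) = u (v \<odot>\<^bsub>N\<^esub> (t \<odot>\<^bsub>N\<^esub> m))"
      by simp
    then have "\<phi> v \<odot>\<^bsub>N'\<^esub> (\<phi> s \<odot>\<^bsub>N'\<^esub> u n) = \<phi> v \<odot>\<^bsub>N'\<^esub> (\<phi> t \<odot>\<^bsub>N'\<^esub> u m)"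
      using n m v(1) by (simp add: semilinear)
    then show ?thesis
      using n m v(1) \<phi> u by (subst N'.fraction_eq_iff) auto
  qed
  then show ?thesis
    unfolding fraction_map_def by (rule N.UN_fraction[OF m])
qed

text \<open>
  The section \<open>\<sigma>\<close> lifts denominators of the factor to denominators of \<open>A\<close>; for a product it is
  \<open>s \<mapsto> (1, \<dots>, s, \<dots>, 1)\<close>. Since \<open>\<pi> (\<sigma> t) = t\<close>, the elements \<open>\<sigma> t\<close> and \<open>\<iota> t\<close> agree after
  multiplication by \<open>e\<close>, which is what makes \<open>y / t \<mapsto> j y / \<sigma> t\<close> well defined.
\<close>

locale localized_factor = module_factor A B \<pi> \<iota> N N' p j
  for A :: "('a, 'm) ring_scheme" and B :: "('b, 'n) ring_scheme" and \<pi> \<iota>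
    and N :: "('a, 'c, 'k) module_scheme" and N' :: "('b, 'd, 'l) module_scheme" and p j +
  fixes T :: "'a set" and T' :: "'b set" and \<sigma> :: "'b \<Rightarrow> 'a"
  assumes submonoids: "submonoid T A" "submonoid T' B"
    and proj_denominator [simp]: "s \<in> T \<Longrightarrow> \<pi> s \<in> T'"
    and lift_denominator [simp]: "t \<in> T' \<Longrightarrow> \<sigma> t \<in> T"
    and lift_mult: "\<lbrakk>t \<in> T'; t' \<in> T'\<rbrakk> \<Longrightarrow> \<sigma> (t \<otimes>\<^bsub>B\<^esub> t') = \<sigma> t \<otimes>\<^bsub>A\<^esub> \<sigma> t'"
    and lift_one: "\<sigma> \<one>\<^bsub>B\<^esub> = \<one>\<^bsub>A\<^esub>"
    and proj_lift [simp]: "t \<in> T' \<Longrightarrow> \<pi> (\<sigma> t) = t"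
begin

abbreviation "p_loc \<equiv> fraction_map T' N' p \<pi>"
abbreviation "j_loc \<equiv> fraction_map T N j \<sigma>"
abbreviation "\<pi>_loc \<equiv> fraction_map T' (ring_as_module B) \<pi> \<pi>"
abbreviation "\<iota>_loc \<equiv> fraction_map T (ring_as_module A) \<iota> \<sigma>"

lemma fractions: "module_fractions A N T" "module_fractions B N' T'"
  by (intro module_fractions.intro module_fractions_axioms.intro submonoids
      N.module_axioms N'.module_axioms)+

sublocale NT: module_fractions A N T by (rule fractions)
sublocale NT': module_fractions B N' T' by (rule fractions)

lemma lift_smult_unit:
  assumes "t \<in> T'"
  shows "\<sigma> t \<otimes>\<^bsub>A\<^esub> \<iota> \<one>\<^bsub>B\<^esub> = \<iota> t"
  using incl_proj[of "\<sigma> t"] assms by (simp add: A.m_comm)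

lemma lift_smult_j:
  assumes "t \<in> T'" "y \<in> carrier N'"
  shows "j (t \<odot>\<^bsub>N'\<^esub> y) = \<sigma> t \<odot>\<^bsub>N\<^esub> j y"
proof -
  have "j (t \<odot>\<^bsub>N'\<^esub> y) = (\<sigma> t \<otimes>\<^bsub>A\<^esub> \<iota> \<one>\<^bsub>B\<^esub>) \<odot>\<^bsub>N\<^esub> j y"
    using assms by (simp add: j_smult lift_smult_unit)
  also have "\<dots> = \<sigma> t \<odot>\<^bsub>N\<^esub> j y"
    using assms by (simp add: N.smult_assoc1 unit_smult_j)
  finally show ?thesis .
qed

lemma p_loc_fraction:
  "\<lbrakk>x \<in> carrier N; s \<in> T\<rbrakk> \<Longrightarrow> p_loc (fraction T N x s) = fraction T' N' (p x) (\<pi> s)"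
  by (rule fraction_map_fraction[OF fractions]) (simp_all add: p_smult)

lemma j_loc_fraction:
  "\<lbrakk>y \<in> carrier N'; t \<in> T'\<rbrakk> \<Longrightarrow> j_loc (fraction T' N' y t) = fraction T N (j y) (\<sigma> t)"
  by (rule fraction_map_fraction[OF fractions(2,1)]) (simp_all add: lift_smult_j)

lemma p_loc_closed:
  "x \<in> carrier (localized_module A T N) \<Longrightarrow> p_loc x \<in> carrier (localized_module B T' N')"
  by (elim NT.fractionE) (simp add: p_loc_fraction)

lemma j_loc_closed:
  "x \<in> carrier (localized_module B T' N') \<Longrightarrow> j_loc x \<in> carrier (localized_module A T N)"
  by (elim NT'.fractionE) (simp add: j_loc_fraction)

lemma p_loc_add:
  "\<lbrakk>x \<in> carrier (localized_module A T N); y \<in> carrier (localized_module A T N)\<rbrakk> \<Longrightarrow>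
    p_loc (x \<oplus>\<^bsub>localized_module A T N\<^esub> y) = p_loc x \<oplus>\<^bsub>localized_module B T' N'\<^esub> p_loc y"
  by (elim NT.fractionE)
    (simp add: p_loc_fraction p_add p_smult ring_hom_mult[OF proj_hom])

lemma j_loc_add:
  "\<lbrakk>x \<in> carrier (localized_module B T' N'); y \<in> carrier (localized_module B T' N')\<rbrakk> \<Longrightarrow>
    j_loc (x \<oplus>\<^bsub>localized_module B T' N'\<^esub> y) = j_loc x \<oplus>\<^bsub>localized_module A T N\<^esub> j_loc y"
  by (elim NT'.fractionE) (simp add: j_loc_fraction j_add lift_smult_j lift_mult)

lemma p_loc_j_loc: "x \<in> carrier (localized_module B T' N') \<Longrightarrow> p_loc (j_loc x) = x"
  by (elim NT'.fractionE) (simp add: p_loc_fraction j_loc_fraction)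

text \<open>
  The fraction \<open>(e x) / \<sigma> (\<pi> s)\<close> equals \<open>(e x) / s\<close>, because \<open>\<sigma> (\<pi> s) e = \<iota> (\<pi> s) = s e\<close>.
\<close>

lemma j_loc_p_loc_fraction:
  assumes "x \<in> carrier N" "s \<in> T"
  shows "j_loc (p_loc (fraction T N x s)) = fraction T N (\<iota> \<one>\<^bsub>B\<^esub> \<odot>\<^bsub>N\<^esub> x) s"
proof -
  have "s \<otimes>\<^bsub>A\<^esub> \<iota> \<one>\<^bsub>B\<^esub> = \<sigma> (\<pi> s) \<otimes>\<^bsub>A\<^esub> \<iota> \<one>\<^bsub>B\<^esub>"
    using assms incl_proj[of s] lift_smult_unit[of "\<pi> s"] A.m_comm[of "\<iota> \<one>\<^bsub>B\<^esub>" s] by simp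
  then show ?thesis
    using assms by (simp add: p_loc_fraction j_loc_fraction j_p)
      (intro NT.fraction_eqI; simp flip: N.smult_assoc1)
qed

text \<open>
  The maps \<open>\<pi>_loc\<close> and \<open>\<iota>_loc\<close> are \<open>p_loc\<close> and \<open>j_loc\<close> for the rings as modules over themselves, so
  the ring case inherits the module case.
\<close>

lemma localized_factor_self:
  "localized_factor A B \<pi> \<iota> (ring_as_module A) (ring_as_module B) \<pi> \<iota> T T' \<sigma>"
  by (intro localized_factor.intro module_factor_self localized_factor_axioms.intro submonoids)
    (simp_all add: lift_mult lift_one)

lemma localized_unit: "\<iota>_loc \<one>\<^bsub>localized_ring B T'\<^esub> = localization_map A T (\<iota> \<one>\<^bsub>B\<^esub>)"
  using localized_factor.j_loc_fraction[OF localized_factor_self, of "\<one>\<^bsub>B\<^esub>" "\<one>\<^bsub>B\<^esub>"]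
  by (simp add: localization_map_def lift_one)

lemma ring_factor_localized_ring:
  "ring_factor (localized_ring A T) (localized_ring B T') \<pi>_loc \<iota>_loc"
proof -
  interpret R: localized_factor A B \<pi> \<iota> "ring_as_module A" "ring_as_module B" \<pi> \<iota> T T' \<sigma>
    by (rule localized_factor_self)
  interpret A': cring "localized_ring A T"
    by (intro cring_localized_ring A.is_cring submonoids)
  interpret B': cring "localized_ring B T'"
    by (intro cring_localized_ring B.is_cring submonoids)
  show ?thesis
  proof
    show "\<pi>_loc \<in> ring_hom (localized_ring A T) (localized_ring B T')"
    proof (rule ring_hom_memI)
      fix x y
      assume "x \<in> carrier (localized_ring A T)" "y \<in> carrier (localized_ring A T)"
      then show "\<pi>_loc (x \<otimes>\<^bsub>localized_ring A T\<^esub> y) = \<pi>_loc x \<otimes>\<^bsub>localized_ring B T'\<^esub> \<pi>_loc y"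
        by simp (elim R.NT.fractionE; simp add: R.p_loc_fraction[simplified]
            R.NT.smult_fractions[simplified] R.NT'.smult_fractions[simplified]
            ring_hom_mult[OF proj_hom])
      show "\<pi>_loc (x \<oplus>\<^bsub>localized_ring A T\<^esub> y) = \<pi>_loc x \<oplus>\<^bsub>localized_ring B T'\<^esub> \<pi>_loc y"
        using \<open>x \<in> _\<close> \<open>y \<in> _\<close> by (simp add: R.p_loc_add)
    next
      show "\<pi>_loc \<one>\<^bsub>localized_ring A T\<^esub> = \<one>\<^bsub>localized_ring B T'\<^esub>"
        using R.p_loc_fraction[of "\<one>\<^bsub>A\<^esub>" "\<one>\<^bsub>A\<^esub>"]
        by (simp add: localization_map_def ring_hom_one[OF proj_hom])
    qed (simp add: R.p_loc_closed)
  next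
    fix x y
    assume "x \<in> carrier (localized_ring B T')" "y \<in> carrier (localized_ring B T')"
    then show "\<iota>_loc (x \<otimes>\<^bsub>localized_ring B T'\<^esub> y) = \<iota>_loc x \<otimes>\<^bsub>localized_ring A T\<^esub> \<iota>_loc y"
      by simp (elim R.NT'.fractionE; simp add: R.j_loc_fraction[simplified]
          R.NT.smult_fractions[simplified] R.NT'.smult_fractions[simplified] incl_mult lift_mult)
  next
    fix x
    assume "x \<in> carrier (localized_ring A T)"
    then show "\<iota>_loc (\<pi>_loc x) =
        \<iota>_loc \<one>\<^bsub>localized_ring B T'\<^esub> \<otimes>\<^bsub>localized_ring A T\<^esub> x"
      unfolding localized_unit
      by simp (elim R.NT.fractionE; simp add: R.j_loc_p_loc_fraction[simplified]
          localization_map_def R.NT.smult_fractions[simplified])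
  qed (simp_all add: R.j_loc_closed R.j_loc_add R.p_loc_j_loc)
qed

lemma module_factor_localized_module:
  "module_factor (localized_ring A T) (localized_ring B T') \<pi>_loc \<iota>_loc
     (localized_module A T N) (localized_module B T' N') p_loc j_loc"
proof -
  interpret R: localized_factor A B \<pi> \<iota> "ring_as_module A" "ring_as_module B" \<pi> \<iota> T T' \<sigma>
    by (rule localized_factor_self)
  show ?thesis
  proof (intro module_factor.intro module_factor_axioms.intro ring_factor_localized_ring
      NT.module_localized_module NT'.module_localized_module)
    fix a x
    assume "a \<in> carrier (localized_ring A T)" "x \<in> carrier (localized_module A T N)"
    then show "p_loc (a \<odot>\<^bsub>localized_module A T N\<^esub> x) = \<pi>_loc a \<odot>\<^bsub>localized_module B T' N'\<^esub> p_loc x"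
      by simp (elim NT.fractionE R.NT.fractionE; simp add: R.p_loc_fraction[simplified]
          p_loc_fraction p_smult ring_hom_mult[OF proj_hom])
  next
    fix b y
    assume "b \<in> carrier (localized_ring B T')" "y \<in> carrier (localized_module B T' N')"
    then show "j_loc (b \<odot>\<^bsub>localized_module B T' N'\<^esub> y) = \<iota>_loc b \<odot>\<^bsub>localized_module A T N\<^esub> j_loc y"
      by simp (elim NT'.fractionE R.NT'.fractionE; simp add: R.j_loc_fraction[simplified]
          j_loc_fraction j_smult lift_mult)
  next
    fix x
    assume "x \<in> carrier (localized_module A T N)"
    then show "j_loc (p_loc x) = \<iota>_loc \<one>\<^bsub>localized_ring B T'\<^esub> \<odot>\<^bsub>localized_module A T N\<^esub> x"
      unfolding localized_unit
      by (elim NT.fractionE) (simp add: j_loc_p_loc_fraction localization_map_def)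
  qed (simp_all add: p_loc_closed j_loc_closed p_loc_add j_loc_add p_loc_j_loc)
qed

lemma module_factor_localized_restricted:
  "module_factor A B \<pi> \<iota>
     (restrict_scalars (localization_map A T) (localized_module A T N))
     (restrict_scalars (localization_map B T') (localized_module B T' N')) p_loc j_loc"
proof -
  interpret R: localized_factor A B \<pi> \<iota> "ring_as_module A" "ring_as_module B" \<pi> \<iota> T T' \<sigma>
    by (rule localized_factor_self)
  show ?thesis
  proof (rule module_factor_restrict_along[OF module_factor_localized_module ring_factor_axioms])
    show "localization_map A T \<in> ring_hom A (localized_ring A T)"
      and "localization_map B T' \<in> ring_hom B (localized_ring B T')"
      by (intro localization_map_ring_hom A.is_cring B.is_cring submonoids)+
    show "\<pi>_loc (localization_map A T c) = localization_map B T' (\<pi> c)" if "c \<in> carrier A" for c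
      using that by (simp add: localization_map_def R.p_loc_fraction[simplified] ring_hom_one[OF proj_hom])
    show "\<iota>_loc (localization_map B T' d) = localization_map A T (\<iota> d)" if "d \<in> carrier B" for d
      using that by (simp add: localization_map_def R.j_loc_fraction[simplified] lift_one)
  qed
qed

end

lemma (in ring_decomposition) S_projective_iff_factors:
  assumes factors: "\<And>i. i \<in> I \<Longrightarrow>
      localized_factor A (B i) (\<pi> i) (\<iota> i) N (N' i) (p i) (j i) T (T' i) (\<sigma> i)"
    and N: "module A N" and T: "submonoid T A"
  shows "S_projective TYPE('u) A T N \<longleftrightarrow> (\<forall>i\<in>I. S_projective TYPE('u) (B i) (T' i) (N' i))"
proof -
  note restricted = localized_factor.module_factor_localized_restricted[OF factors]
  have "module A (restrict_scalars (localization_map A T) (localized_module A T N))"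
    by (intro module_restrict_scalars[OF A.is_cring localization_map_ring_hom[OF A.is_cring T]]
        module_fractions.module_localized_module module_fractions.intro
        module_fractions_axioms.intro N T)
  then show ?thesis
    unfolding S_projective_def
    using projective_module_factor[OF restricted] projective_module_if_factors[OF _ restricted]
    by blast
qed

text \<open>
  Here the ground rings are localized as well. The idempotents of the localized factors are the
  images of the \<open>e\<^sub>i\<close> under the localization homomorphism, so they again sum to \<open>1\<close>.
\<close>

lemma (in ring_decomposition) S_flat_iff_factors:
  assumes factors: "\<And>i. i \<in> I \<Longrightarrow>
      localized_factor A (B i) (\<pi> i) (\<iota> i) N (N' i) (p i) (j i) T (T' i) (\<sigma> i)"
    and N: "module A N" and T: "submonoid T A"
  shows "S_flat TYPE('u) A T N \<longleftrightarrow> (\<forall>i\<in>I. S_flat TYPE('u) (B i) (T' i) (N' i))"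
proof -
  define \<pi>' where "\<pi>' i = fraction_map (T' i) (ring_as_module (B i)) (\<pi> i) (\<pi> i)" for i
  define \<iota>' where "\<iota>' i = fraction_map T (ring_as_module A) (\<iota> i) (\<sigma> i)" for i
  note loc_ring = localized_factor.ring_factor_localized_ring[OF factors, folded \<pi>'_def \<iota>'_def]
  note loc_module = localized_factor.module_factor_localized_module[OF factors, folded \<pi>'_def \<iota>'_def]
  note unit = localized_factor.localized_unit[OF factors, folded \<iota>'_def]
  interpret loc: cring "localized_ring A T"
    by (rule cring_localized_ring[OF A.is_cring T])
  interpret hom: ring_hom_cring A "localized_ring A T" "localization_map A T"
    by (intro ring_hom_cring.intro A.is_cring loc.is_cring ring_hom_cring_axioms.intro
        localization_map_ring_hom T)
  have "(\<Oplus>\<^bsub>localized_ring A T\<^esub>i\<in>I. \<iota>' i \<one>\<^bsub>localized_ring (B i) (T' i)\<^esub>) =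
      (\<Oplus>\<^bsub>localized_ring A T\<^esub>i\<in>I. localization_map A T (\<iota> i \<one>\<^bsub>B i\<^esub>))"
    by (intro loc.finsum_cong' refl unit funcsetI hom.hom_closed unit_closed)
  also have "\<dots> = localization_map A T (\<Oplus>\<^bsub>A\<^esub>i\<in>I. \<iota> i \<one>\<^bsub>B i\<^esub>)"
    using hom.hom_finsum[of "\<lambda>i. \<iota> i \<one>\<^bsub>B i\<^esub>" I] unit_closed by (simp only: o_def Pi_I)
  also have "\<dots> = \<one>\<^bsub>localized_ring A T\<^esub>"
    unfolding sum_units by (rule hom.hom_one)
  finally interpret loc: ring_decomposition "localized_ring A T" I
      "\<lambda>i. localized_ring (B i) (T' i)" \<pi>' \<iota>'
    by (intro ring_decomposition.intro ring_decomposition_axioms.intro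
        loc.is_cring finite_index loc_ring)
  have "module (localized_ring A T) (localized_module A T N)"
    by (intro module_fractions.module_localized_module module_fractions.intro
        module_fractions_axioms.intro N T)
  then show ?thesis
    unfolding S_flat_def
    using flat_module_factor[OF loc_module] loc.flat_module_if_factors[OF _ loc_module]
    by blast
qed

section \<open>Finite products of rings\<close>

text \<open>
  The product ring is built by transport along injections; its operations are made explicit here so
  that equations can be checked entry by entry.
\<close>

lemma RDirProd_list_Cons:
  assumes "x \<in> carrier (RDirProd_list (R # Rs))" "y \<in> carrier (RDirProd_list (R # Rs))"
  shows "x \<otimes>\<^bsub>RDirProd_list (R # Rs)\<^esub> y = (hd x \<otimes>\<^bsub>R\<^esub> hd y) # (tl x \<otimes>\<^bsub>RDirProd_list Rs\<^esub> tl y)"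
    and "x \<oplus>\<^bsub>RDirProd_list (R # Rs)\<^esub> y = (hd x \<oplus>\<^bsub>R\<^esub> hd y) # (tl x \<oplus>\<^bsub>RDirProd_list Rs\<^esub> tl y)"
    and "hd x \<in> carrier R" "tl x \<in> carrier (RDirProd_list Rs)" "x = hd x # tl x"
proof -
  obtain a as where x: "x = a # as" "a \<in> carrier R" "as \<in> carrier (RDirProd_list Rs)"
    using assms(1) by (auto simp: RDirProd_list_carrier)
  obtain b bs where y: "y = b # bs" "b \<in> carrier R" "bs \<in> carrier (RDirProd_list Rs)"
    using assms(2) by (auto simp: RDirProd_list_carrier)
  have carrier: "(a, as) \<in> carrier (RDirProd R (RDirProd_list Rs))"
      "(b, bs) \<in> carrier (RDirProd R (RDirProd_list Rs))"
    using x y by (simp_all add: RDirProd_carrier)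
  show "x \<otimes>\<^bsub>RDirProd_list (R # Rs)\<^esub> y = (hd x \<otimes>\<^bsub>R\<^esub> hd y) # (tl x \<otimes>\<^bsub>RDirProd_list Rs\<^esub> tl y)"
    using ring_hom_mult[OF RDirProd_list_hom1 carrier] x y by (simp add: RDirProd_def DirProd_def monoid.defs)
  show "x \<oplus>\<^bsub>RDirProd_list (R # Rs)\<^esub> y = (hd x \<oplus>\<^bsub>R\<^esub> hd y) # (tl x \<oplus>\<^bsub>RDirProd_list Rs\<^esub> tl y)"
    using ring_hom_add[OF RDirProd_list_hom1 carrier] x y by (simp add: RDirProd_def DirProd_def monoid.defs)
  show "hd x \<in> carrier R" "tl x \<in> carrier (RDirProd_list Rs)" "x = hd x # tl x"
    using x by auto
qed

lemma RDirProd_list_nth: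
  assumes "x \<in> carrier (RDirProd_list Rs)" "y \<in> carrier (RDirProd_list Rs)" "i < length Rs"
  shows "(x \<otimes>\<^bsub>RDirProd_list Rs\<^esub> y) ! i = x ! i \<otimes>\<^bsub>Rs ! i\<^esub> y ! i"
    and "(x \<oplus>\<^bsub>RDirProd_list Rs\<^esub> y) ! i = x ! i \<oplus>\<^bsub>Rs ! i\<^esub> y ! i"
proof -
  have "(x \<otimes>\<^bsub>RDirProd_list Rs\<^esub> y) ! i = x ! i \<otimes>\<^bsub>Rs ! i\<^esub> y ! i \<and>
      (x \<oplus>\<^bsub>RDirProd_list Rs\<^esub> y) ! i = x ! i \<oplus>\<^bsub>Rs ! i\<^esub> y ! i"
    using assms
  proof (induction Rs arbitrary: x y i)
    case (Cons R Rs)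
    note x = RDirProd_list_Cons[OF Cons.prems(1,2)] and y = RDirProd_list_Cons[OF Cons.prems(2,1)]
    show ?case
    proof (cases i)
      case 0
      then show ?thesis
        using x(1,2,5) y(5) by (metis nth_Cons_0)
    next
      case (Suc k)
      then show ?thesis
        using Cons.IH[OF x(4) y(4), of k] Cons.prems(3) x(1,2,5) y(5)
        by (metis Suc_less_eq length_Cons nth_Cons_Suc)
    qed
  qed simp
  then show "(x \<otimes>\<^bsub>RDirProd_list Rs\<^esub> y) ! i = x ! i \<otimes>\<^bsub>Rs ! i\<^esub> y ! i"
    "(x \<oplus>\<^bsub>RDirProd_list Rs\<^esub> y) ! i = x ! i \<oplus>\<^bsub>Rs ! i\<^esub> y ! i" by auto
qed

lemma RDirProd_list_one_zero:
  "\<one>\<^bsub>RDirProd_list Rs\<^esub> = map monoid.one Rs" "\<zero>\<^bsub>RDirProd_list Rs\<^esub> = map ring.zero Rs"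
  unfolding RDirProd_list_one RDirProd_list_zero by (induction Rs) simp_all

lemma RDirProd_list_eqI:
  assumes "x \<in> carrier (RDirProd_list Rs)" "y \<in> carrier (RDirProd_list Rs)"
    and "\<And>i. i < length Rs \<Longrightarrow> x ! i = y ! i"
  shows "x = y"
  using assms(3) RDirProd_list_carrier_mem(1)[OF assms(1)] RDirProd_list_carrier_mem(1)[OF assms(2)]
  by (intro nth_equalityI) simp_all

lemma cring_RDirProd_list:
  assumes "\<And>i. i < length Rs \<Longrightarrow> cring (Rs ! i)"
  shows "cring (RDirProd_list Rs)"
proof -
  interpret ring "RDirProd_list Rs"
    by (rule RDirProd_list_is_ring) (simp add: assms cring.axioms)
  show ?thesis
  proof (intro cring.intro ring_axioms comm_monoid.intro monoid_axioms comm_monoid_axioms.intro)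
    fix x y
    assume xy: "x \<in> carrier (RDirProd_list Rs)" "y \<in> carrier (RDirProd_list Rs)"
    show "x \<otimes>\<^bsub>RDirProd_list Rs\<^esub> y = y \<otimes>\<^bsub>RDirProd_list Rs\<^esub> x"
    proof (rule RDirProd_list_eqI)
      fix i
      assume i: "i < length Rs"
      interpret Ri: cring "Rs ! i" by (rule assms[OF i])
      show "(x \<otimes>\<^bsub>RDirProd_list Rs\<^esub> y) ! i = (y \<otimes>\<^bsub>RDirProd_list Rs\<^esub> x) ! i"
        using xy i by (simp add: RDirProd_list_nth RDirProd_list_carrier_mem(2) Ri.m_comm)
    qed (use xy in auto)
  qed
qed

lemma listset_iff:
  "xs \<in> listset As \<longleftrightarrow> length xs = length As \<and> (\<forall>i<length As. xs ! i \<in> As ! i)"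
proof (induction As arbitrary: xs)
  case (Cons A As)
  then show ?case
    by (cases xs) (auto simp: set_Cons_def All_less_Suc2)
qed simp

lemma component_embedding_nth:
  "\<lbrakk>i < length Rs; k < length Rs\<rbrakk> \<Longrightarrow>
    component_embedding Rs i r ! k = (if k = i then r else \<zero>\<^bsub>Rs ! k\<^esub>)"
  by (simp add: component_embedding_def nth_list_update)

lemma component_module_eq_factor_module:
  "component_module Rs i M = factor_module (Rs ! i) (component_embedding Rs i) M"
  by (simp add: component_module_def factor_module_def component_idempotent_def)

context
  fixes Rs :: "('a, 'm) ring_scheme list"
  assumes cring_component: "\<And>i. i < length Rs \<Longrightarrow> cring (Rs ! i)"
begin

lemma component_embedding_closed:
  assumes "i < length Rs" "r \<in> carrier (Rs ! i)"
  shows "component_embedding Rs i r \<in> carrier (RDirProd_list Rs)"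
proof (rule RDirProd_list_carrier_memI)
  fix k
  assume k: "k < length Rs"
  interpret cring "Rs ! k" by (rule cring_component[OF k])
  show "component_embedding Rs i r ! k \<in> carrier (Rs ! k)"
    using assms k by (simp add: component_embedding_nth)
qed (simp add: component_embedding_def)

lemma component_projection_ring_hom:
  assumes "i < length Rs"
  shows "(\<lambda>x. x ! i) \<in> ring_hom (RDirProd_list Rs) (Rs ! i)"
  using assms
  by (intro ring_hom_memI) (simp_all add: RDirProd_list_nth RDirProd_list_carrier_mem RDirProd_list_one_zero)

lemma ring_factor_component:
  assumes i: "i < length Rs"
  shows "ring_factor (RDirProd_list Rs) (Rs ! i) (\<lambda>x. x ! i) (component_embedding Rs i)"
proof -
  interpret A: cring "RDirProd_list Rs" by (rule cring_RDirProd_list[OF cring_component])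
  interpret B: cring "Rs ! i" by (rule cring_component[OF i])
  note embedding = component_embedding_closed[OF i]
  show ?thesis
  proof
    show "(\<lambda>x. x ! i) \<in> ring_hom (RDirProd_list Rs) (Rs ! i)"
      by (rule component_projection_ring_hom[OF i])
  next
    fix b c
    assume bc: "b \<in> carrier (Rs ! i)" "c \<in> carrier (Rs ! i)"
    show "component_embedding Rs i (b \<oplus>\<^bsub>Rs ! i\<^esub> c) =
        component_embedding Rs i b \<oplus>\<^bsub>RDirProd_list Rs\<^esub> component_embedding Rs i c"
    proof (rule RDirProd_list_eqI)
      fix k
      assume k: "k < length Rs"
      interpret Rk: cring "Rs ! k" by (rule cring_component[OF k])
      show "component_embedding Rs i (b \<oplus>\<^bsub>Rs ! i\<^esub> c) ! k =
          (component_embedding Rs i b \<oplus>\<^bsub>RDirProd_list Rs\<^esub> component_embedding Rs i c) ! k"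
        using i k bc by (simp add: RDirProd_list_nth embedding component_embedding_nth)
    qed (use bc embedding in auto)
    show "component_embedding Rs i (b \<otimes>\<^bsub>Rs ! i\<^esub> c) =
        component_embedding Rs i b \<otimes>\<^bsub>RDirProd_list Rs\<^esub> component_embedding Rs i c"
    proof (rule RDirProd_list_eqI)
      fix k
      assume k: "k < length Rs"
      interpret Rk: cring "Rs ! k" by (rule cring_component[OF k])
      show "component_embedding Rs i (b \<otimes>\<^bsub>Rs ! i\<^esub> c) ! k =
          (component_embedding Rs i b \<otimes>\<^bsub>RDirProd_list Rs\<^esub> component_embedding Rs i c) ! k"
        using i k bc by (simp add: RDirProd_list_nth embedding component_embedding_nth)
    qed (use bc embedding in auto)
  next
    fix a
    assume a: "a \<in> carrier (RDirProd_list Rs)"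
    show "component_embedding Rs i (a ! i) =
        component_embedding Rs i \<one>\<^bsub>Rs ! i\<^esub> \<otimes>\<^bsub>RDirProd_list Rs\<^esub> a"
    proof (rule RDirProd_list_eqI)
      fix k
      assume k: "k < length Rs"
      interpret Rk: cring "Rs ! k" by (rule cring_component[OF k])
      show "component_embedding Rs i (a ! i) ! k =
          (component_embedding Rs i \<one>\<^bsub>Rs ! i\<^esub> \<otimes>\<^bsub>RDirProd_list Rs\<^esub> a) ! k"
        using i k a RDirProd_list_carrier_mem(2)[OF a]
        by (simp add: RDirProd_list_nth embedding component_embedding_nth)
    qed (use a embedding RDirProd_list_carrier_mem(2)[OF a i] in auto)
  qed (use i embedding in \<open>simp_all add: component_embedding_nth\<close>)
qed

lemma ring_decomposition_components:
  "ring_decomposition (RDirProd_list Rs) {..<length Rs} (\<lambda>i. Rs ! i) (\<lambda>i x. x ! i)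
     (component_embedding Rs)"
proof -
  interpret A: cring "RDirProd_list Rs" by (rule cring_RDirProd_list[OF cring_component])
  define e where "e i = component_embedding Rs i \<one>\<^bsub>Rs ! i\<^esub>" for i
  have e: "e i \<in> carrier (RDirProd_list Rs)" if "i < length Rs" for i
  proof -
    interpret cring "Rs ! i" by (rule cring_component[OF that])
    show ?thesis using that by (simp add: e_def component_embedding_closed)
  qed
  have "(\<Oplus>\<^bsub>RDirProd_list Rs\<^esub>i\<in>{..<length Rs}. e i) = \<one>\<^bsub>RDirProd_list Rs\<^esub>"
  proof (rule RDirProd_list_eqI)
    fix k
    assume k: "k < length Rs"
    interpret Rk: cring "Rs ! k" by (rule cring_component[OF k])
    interpret hom: ring_hom_cring "RDirProd_list Rs" "Rs ! k" "\<lambda>x. x ! k"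
      by (intro ring_hom_cring.intro A.is_cring Rk.is_cring ring_hom_cring_axioms.intro
          component_projection_ring_hom k)
    have "(\<Oplus>\<^bsub>RDirProd_list Rs\<^esub>i\<in>{..<length Rs}. e i) ! k = (\<Oplus>\<^bsub>Rs ! k\<^esub>i\<in>{..<length Rs}. e i ! k)"
      using hom.hom_finsum[of e "{..<length Rs}"] e by (simp add: o_def Pi_def)
    also have "\<dots> = (\<Oplus>\<^bsub>Rs ! k\<^esub>i\<in>{..<length Rs}. if k = i then \<one>\<^bsub>Rs ! k\<^esub> else \<zero>\<^bsub>Rs ! k\<^esub>)"
      using k
    proof (intro Rk.finsum_cong' funcsetI)
      show "(if k = i then \<one>\<^bsub>Rs ! k\<^esub> else \<zero>\<^bsub>Rs ! k\<^esub>) \<in> carrier (Rs ! k)" for i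
        using Rk.one_closed Rk.zero_closed by metis
    qed (simp_all add: e_def component_embedding_nth)
    also have "\<dots> = \<one>\<^bsub>Rs ! k\<^esub>"
      using k by (intro Rk.finsum_singleton funcsetI) simp_all
    finally show "(\<Oplus>\<^bsub>RDirProd_list Rs\<^esub>i\<in>{..<length Rs}. e i) ! k = \<one>\<^bsub>RDirProd_list Rs\<^esub> ! k"
      using k by (simp add: RDirProd_list_one_zero)
  next
    show "(\<Oplus>\<^bsub>RDirProd_list Rs\<^esub>i\<in>{..<length Rs}. e i) \<in> carrier (RDirProd_list Rs)"
      using e by (intro A.finsum_closed funcsetI) simp
  qed (rule A.one_closed)
  then show ?thesis
    by (intro ring_decomposition.intro ring_decomposition_axioms.intro A.is_cring)
      (simp_all add: e_def ring_factor_component)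
qed

lemma submonoid_listset:
  assumes "length Ss = length Rs" "\<And>i. i < length Rs \<Longrightarrow> submonoid (Ss ! i) (Rs ! i)"
  shows "submonoid (listset Ss) (RDirProd_list Rs)"
proof
  interpret A: cring "RDirProd_list Rs" by (rule cring_RDirProd_list[OF cring_component])
  show subset: "listset Ss \<subseteq> carrier (RDirProd_list Rs)"
    by (intro subsetI RDirProd_list_carrier_memI)
      (simp_all add: listset_iff assms(1) submonoid.mem_carrier[OF assms(2)])
  show "\<one>\<^bsub>RDirProd_list Rs\<^esub> \<in> listset Ss"
    using assms submonoid.one_closed by (auto simp: listset_iff RDirProd_list_one_zero)
  fix x y
  assume xy: "x \<in> listset Ss" "y \<in> listset Ss"
  then have carrier: "x \<in> carrier (RDirProd_list Rs)" "y \<in> carrier (RDirProd_list Rs)"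
    using subset by auto
  show "x \<otimes>\<^bsub>RDirProd_list Rs\<^esub> y \<in> listset Ss"
    using xy carrier RDirProd_list_carrier_mem(1)[OF A.m_closed[OF carrier]]
    by (simp add: listset_iff RDirProd_list_nth assms(1) submonoid.m_closed[OF assms(2)])
qed

lemma localized_factor_component:
  assumes i: "i < length Rs" and M: "module (RDirProd_list Rs) M"
    and Ss: "length Ss = length Rs" "\<And>i. i < length Rs \<Longrightarrow> submonoid (Ss ! i) (Rs ! i)"
  shows "localized_factor (RDirProd_list Rs) (Rs ! i) (\<lambda>x. x ! i) (component_embedding Rs i)
    M (component_module Rs i M) (\<lambda>x. component_idempotent Rs i \<odot>\<^bsub>M\<^esub> x) (\<lambda>x. x)
    (listset Ss) (Ss ! i) (\<lambda>s. (map monoid.one Rs)[i := s])"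
proof -
  interpret A: cring "RDirProd_list Rs" by (rule cring_RDirProd_list[OF cring_component])
  interpret ring_factor "RDirProd_list Rs" "Rs ! i" "\<lambda>x. x ! i" "component_embedding Rs i"
    by (rule ring_factor_component[OF i])
  note sub = submonoid_listset[OF Ss]
  have lift: "(map monoid.one Rs)[i := s] \<in> listset Ss" if "s \<in> Ss ! i" for s
    using that i Ss submonoid.one_closed[OF Ss(2)] by (auto simp: listset_iff nth_list_update)
  note lift_carrier = submonoid.mem_carrier[OF sub lift]
  have "(map monoid.one Rs)[i := s \<otimes>\<^bsub>Rs ! i\<^esub> t] =
      (map monoid.one Rs)[i := s] \<otimes>\<^bsub>RDirProd_list Rs\<^esub> (map monoid.one Rs)[i := t]"
    if st: "s \<in> Ss ! i" "t \<in> Ss ! i" for s t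
  proof (rule RDirProd_list_eqI)
    fix k
    assume k: "k < length Rs"
    interpret Rk: cring "Rs ! k" by (rule cring_component[OF k])
    show "(map monoid.one Rs)[i := s \<otimes>\<^bsub>Rs ! i\<^esub> t] ! k =
      ((map monoid.one Rs)[i := s] \<otimes>\<^bsub>RDirProd_list Rs\<^esub> (map monoid.one Rs)[i := t]) ! k"
      using st i k by (simp add: RDirProd_list_nth lift_carrier nth_list_update)
  qed (use st lift_carrier submonoid.m_closed[OF Ss(2)[OF i]] in auto)
  moreover have "module_factor (RDirProd_list Rs) (Rs ! i) (\<lambda>x. x ! i) (component_embedding Rs i)
      M (component_module Rs i M) (\<lambda>x. component_idempotent Rs i \<odot>\<^bsub>M\<^esub> x) (\<lambda>x. x)"
    using module_factor_factor_module[OF M]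
    by (simp add: component_module_eq_factor_module component_idempotent_def)
  moreover have "(map monoid.one Rs)[i := \<one>\<^bsub>Rs ! i\<^esub>] = map monoid.one Rs"
    using i by (metis list_update_id nth_map)
  ultimately show ?thesis
    using i Ss lift sub
    by (intro localized_factor.intro localized_factor_axioms.intro)
      (auto simp: RDirProd_list_one_zero listset_iff)
qed

end

theorem corollary2p10:
  fixes n :: nat
    and Rs :: "('a, 'm) ring_scheme list"
    and Ss :: "'a set list"
    and M :: "('a list, 'b, 'k) module_scheme"
  assumes "n \<ge> 1" and "length Rs = n" and "length Ss = n"
    and "\<And>i. i < n \<Longrightarrow> cring (Rs ! i)"
    and "\<And>i. i < n \<Longrightarrow> multiplicative_subset (Rs ! i) (Ss ! i)"
    and "module (RDirProd_list Rs) M"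
  shows "(S_projective TYPE('c) (RDirProd_list Rs) (listset Ss) M \<longleftrightarrow>
            (\<forall>i<n. S_projective TYPE('c) (Rs ! i) (Ss ! i) (component_module Rs i M))) \<and>
         (S_flat TYPE('c) (RDirProd_list Rs) (listset Ss) M \<longleftrightarrow>
            (\<forall>i<n. S_flat TYPE('c) (Rs ! i) (Ss ! i) (component_module Rs i M)))"
proof -
  have cring: "\<And>i. i < length Rs \<Longrightarrow> cring (Rs ! i)"
    and Ss: "length Ss = length Rs" "\<And>i. i < length Rs \<Longrightarrow> submonoid (Ss ! i) (Rs ! i)"
    using assms by (simp_all add: multiplicative_subset_def)
  interpret ring_decomposition "RDirProd_list Rs" "{..<length Rs}" "\<lambda>i. Rs ! i" "\<lambda>i x. x ! i"
    "component_embedding Rs"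
    by (rule ring_decomposition_components[OF cring])
  note factors = localized_factor_component[OF cring _ assms(6) Ss]
  note sub = submonoid_listset[OF cring Ss]
  show ?thesis
    using S_projective_iff_factors[OF factors assms(6) sub, where 'u = 'c]
      S_flat_iff_factors[OF factors assms(6) sub, where 'u = 'c] assms(2)
    by (simp add: Ball_def)
qed

end
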